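(* Let $F$ be a non-Archimedean local field, let $R$ be its ring of integers (a compact discrete valuation ring), let $d\ge 1$ be an integer, and let $\operatorname{GL}_d(R)$ act on the additive group $R^d$ by matrix multiplication. Then the central Fourier algebra $\operatorname{ZA}(R^d\rtimes \operatorname{GL}_d(R))$ of the compact group $R^d\rtimes \operatorname{GL}_d(R)$ is not amenable (as a Banach algebra).
   Context: $R^d$ and $\operatorname{GL}_d(R)$ carry their natural compact topologies coming from that of $R$, and $R^d\rtimes\operatorname{GL}_d(R)$ carries the product topology. For a compact group $L$, $\operatorname{A}(L)$ denotes the (Eymard) Fourier algebra of $L$, and the central Fourier algebra is the closed subalgebra $\operatorname{ZA}(L)=\{u\in \operatorname{A}(L): u(gxg^{-1})=u(x)\text{ for all } g,x\in L\}$ of functions constant on conjugacy classes, with the norm of $\operatorname{A}(L)$ and pointwise multiplication. *)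

theory Defs
  imports "HOL-Analysis.Analysis" "HOL-Algebra.Coset" "HOL-Algebra.Module"
begin

section \<open>Non-Archimedean local fields and the group of affine maps over the integers\<close>

text \<open>
  The topology of the field is that of the type class, and it is tied to the absolute value
  by \<open>dist_eq\<close>. Hence \<open>'f^'n\<close>, \<open>'f^'n^'n\<close> and products of these types carry the
  product topology. Completeness, discreteness of the valuation and finiteness of the
  residue field follow from local compactness and non-triviality.
\<close>

locale nonarch_local_field =
  fixes absv :: "'f::{field,metric_space} \<Rightarrow> real"
  assumes absv_nonneg: "absv x \<ge> 0"
    and absv_eq_0_iff: "absv x = 0 \<longleftrightarrow> x = 0"
    and absv_mult: "absv (x * y) = absv x * absv y"
    and absv_ultrametric: "absv (x + y) \<le> max (absv x) (absv y)"
    and absv_nontrivial: "\<exists>x. x \<noteq> 0 \<and> absv x \<noteq> 1"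
    and dist_eq: "dist x y = absv (x - y)"
    and locally_compact: "locally compact (UNIV :: 'f set)"

definition integers_of :: "('f \<Rightarrow> real) \<Rightarrow> 'f set"
  where "integers_of absv = {x. absv x \<le> 1}"

definition integral_vectors :: "('f::field \<Rightarrow> real) \<Rightarrow> ('f^'n) monoid"
  where "integral_vectors absv =
    \<lparr>carrier = {x. \<forall>i. x $ i \<in> integers_of absv}, mult = (+), one = 0\<rparr>"

definition integral_matrices :: "('f::field \<Rightarrow> real) \<Rightarrow> ('f^'n^'n) monoid"
  where "integral_matrices absv =
    \<lparr>carrier = {A. \<forall>i j. A $ i $ j \<in> integers_of absv}, mult = (**), one = mat 1\<rparr>"

definition GL_integers :: "('f::field \<Rightarrow> real) \<Rightarrow> ('f^'n^'n) monoid"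
  where "GL_integers absv = units_of (integral_matrices absv)"

definition semidirect_product ::
  "('a, 'm) monoid_scheme \<Rightarrow> ('b, 'n) monoid_scheme \<Rightarrow> ('b \<Rightarrow> 'a \<Rightarrow> 'a) \<Rightarrow> ('a \<times> 'b) monoid"
  where "semidirect_product N H \<phi> =
    \<lparr>carrier = carrier N \<times> carrier H,
     mult = (\<lambda>(x, g) (y, h). (x \<otimes>\<^bsub>N\<^esub> \<phi> g y, g \<otimes>\<^bsub>H\<^esub> h)),
     one = (\<one>\<^bsub>N\<^esub>, \<one>\<^bsub>H\<^esub>)\<rparr>"

definition affine_integers :: "('f::field \<Rightarrow> real) \<Rightarrow> (('f^'n) \<times> ('f^'n^'n)) monoid"
  where "affine_integers absv =
    semidirect_product (integral_vectors absv) (GL_integers absv) (\<lambda>A x. A *v x)"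

section \<open>The Fourier algebra of a compact group\<close>

text \<open>
  A compact (metrizable) group is a group whose carrier is a compact subset of a metric space
  type and whose operations are continuous for the subspace topology. On such a space every
  finite Borel measure is regular, so a normalized Haar measure is just a left-invariant Borel
  probability measure; it exists and is unique.
\<close>

definition is_haar_measure :: "('g::metric_space, 'm) monoid_scheme \<Rightarrow> 'g measure \<Rightarrow> bool"
  where "is_haar_measure G \<mu> \<longleftrightarrow>
    space \<mu> = carrier G \<and> sets \<mu> = sets (restrict_space borel (carrier G)) \<and> emeasure \<mu> (carrier G) = 1 \<and>
    (\<forall>g\<in>carrier G. \<forall>A\<in>sets \<mu>. emeasure \<mu> (g <#\<^bsub>G\<^esub> A) = emeasure \<mu> A)"

definition haar :: "('g::metric_space, 'm) monoid_scheme \<Rightarrow> 'g measure"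
  where "haar G = (SOME \<mu>. is_haar_measure G \<mu>)"

definition L2 :: "'g measure \<Rightarrow> ('g \<Rightarrow> complex) set"
  where "L2 \<mu> = {\<xi> \<in> borel_measurable \<mu>. integrable \<mu> (\<lambda>x. (cmod (\<xi> x))\<^sup>2)}"

definition L2_norm :: "'g measure \<Rightarrow> ('g \<Rightarrow> complex) \<Rightarrow> real"
  where "L2_norm \<mu> \<xi> = sqrt (\<integral>x. (cmod (\<xi> x))\<^sup>2 \<partial>\<mu>)"

text \<open>
  The coefficient \<open>x \<mapsto> \<langle>\<lambda>(x)\<xi>, \<eta>\<rangle>\<close> of the left regular representation
  \<open>(\<lambda>(x)\<xi>)(y) = \<xi>(x\<inverse>y)\<close>. Functions on the group are extended by 0 outside the carrier, so
  that equality of functions on the type is equality on the group.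
\<close>

definition regular_coefficient ::
  "('g::metric_space, 'm) monoid_scheme \<Rightarrow> ('g \<Rightarrow> complex) \<Rightarrow> ('g \<Rightarrow> complex) \<Rightarrow> 'g \<Rightarrow> complex"
  where "regular_coefficient G \<xi> \<eta> = (\<lambda>x. if x \<in> carrier G
    then \<integral>y. \<xi> (inv\<^bsub>G\<^esub> x \<otimes>\<^bsub>G\<^esub> y) * cnj (\<eta> y) \<partial>(haar G) else 0)"

definition fourier_functions :: "('g::metric_space, 'm) monoid_scheme \<Rightarrow> ('g \<Rightarrow> complex) set"
  where "fourier_functions G =
    {regular_coefficient G \<xi> \<eta> | \<xi> \<eta>. \<xi> \<in> L2 (haar G) \<and> \<eta> \<in> L2 (haar G)}"

definition fourier_norm :: "('g::metric_space, 'm) monoid_scheme \<Rightarrow> ('g \<Rightarrow> complex) \<Rightarrow> real"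
  where "fourier_norm G u =
    Inf {L2_norm (haar G) \<xi> * L2_norm (haar G) \<eta> | \<xi> \<eta>.
      \<xi> \<in> L2 (haar G) \<and> \<eta> \<in> L2 (haar G) \<and> u = regular_coefficient G \<xi> \<eta>}"

text \<open>
  A complex normed space or algebra with an explicit carrier. For a mere space, the
  multiplicative fields inherited from the module record are ignored, as in \<open>Module.module\<close>.
\<close>

record 'x normed_module = "(complex, 'x) module" +
  nrm :: "'x \<Rightarrow> real"

definition central_fourier_algebra ::
  "('g::metric_space, 'm) monoid_scheme \<Rightarrow> ('g \<Rightarrow> complex) normed_module"
  where "central_fourier_algebra G =
    \<lparr>carrier = {u \<in> fourier_functions G.
        \<forall>g\<in>carrier G. \<forall>x\<in>carrier G. u (g \<otimes>\<^bsub>G\<^esub> x \<otimes>\<^bsub>G\<^esub> inv\<^bsub>G\<^esub> g) = u x},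
     mult = (\<lambda>u v x. u x * v x),
     one = (\<lambda>x. if x \<in> carrier G then 1 else 0),
     zero = (\<lambda>x. 0),
     add = (\<lambda>u v x. u x + v x),
     smult = (\<lambda>c u x. c * u x),
     nrm = fourier_norm G\<rparr>"

section \<open>Amenability of Banach algebras\<close>

definition complex_ring :: "complex ring"
  where "complex_ring = \<lparr>carrier = UNIV, mult = (*), one = 1, zero = 0, add = (+)\<rparr>"

locale complex_banach_space =
  Module.module complex_ring X for X :: "'x normed_module" (structure) +
  assumes nrm_nonneg: "x \<in> carrier X \<Longrightarrow> nrm X x \<ge> 0"
    and nrm_eq_0_iff: "x \<in> carrier X \<Longrightarrow> nrm X x = 0 \<longleftrightarrow> x = \<zero>"
    and nrm_triangle: "\<lbrakk>x \<in> carrier X; y \<in> carrier X\<rbrakk> \<Longrightarrow> nrm X (x \<oplus> y) \<le> nrm X x + nrm X y"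
    and nrm_smult: "x \<in> carrier X \<Longrightarrow> nrm X (c \<odot> x) = cmod c * nrm X x"
    and complete: "\<lbrakk>\<And>n. \<sigma> n \<in> carrier X;
      \<And>e. e > 0 \<Longrightarrow> \<exists>N. \<forall>m\<ge>N. \<forall>n\<ge>N. nrm X (\<sigma> m \<ominus> \<sigma> n) < e\<rbrakk>
      \<Longrightarrow> \<exists>x\<in>carrier X. (\<lambda>n::nat. nrm X (\<sigma> n \<ominus> x)) \<longlonglongrightarrow> 0"

text \<open>\<open>l a x\<close> and \<open>r x a\<close> are the left and right actions of the algebra \<open>A\<close> on \<open>X\<close>.\<close>

locale banach_bimodule = complex_banach_space X
  for A :: "'a normed_module" and X :: "'x normed_module"
    and l :: "'a \<Rightarrow> 'x \<Rightarrow> 'x" and r :: "'x \<Rightarrow> 'a \<Rightarrow> 'x" +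
  assumes left_closed: "\<lbrakk>a \<in> carrier A; x \<in> carrier X\<rbrakk> \<Longrightarrow> l a x \<in> carrier X"
    and left_add: "\<lbrakk>a \<in> carrier A; x \<in> carrier X; y \<in> carrier X\<rbrakk>
      \<Longrightarrow> l a (x \<oplus>\<^bsub>X\<^esub> y) = l a x \<oplus>\<^bsub>X\<^esub> l a y"
    and left_smult: "\<lbrakk>a \<in> carrier A; x \<in> carrier X\<rbrakk> \<Longrightarrow> l a (c \<odot>\<^bsub>X\<^esub> x) = c \<odot>\<^bsub>X\<^esub> l a x"
    and add_left: "\<lbrakk>a \<in> carrier A; b \<in> carrier A; x \<in> carrier X\<rbrakk>
      \<Longrightarrow> l (a \<oplus>\<^bsub>A\<^esub> b) x = l a x \<oplus>\<^bsub>X\<^esub> l b x"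
    and smult_left: "\<lbrakk>a \<in> carrier A; x \<in> carrier X\<rbrakk> \<Longrightarrow> l (c \<odot>\<^bsub>A\<^esub> a) x = c \<odot>\<^bsub>X\<^esub> l a x"
    and left_mult: "\<lbrakk>a \<in> carrier A; b \<in> carrier A; x \<in> carrier X\<rbrakk>
      \<Longrightarrow> l (a \<otimes>\<^bsub>A\<^esub> b) x = l a (l b x)"
    and right_closed: "\<lbrakk>a \<in> carrier A; x \<in> carrier X\<rbrakk> \<Longrightarrow> r x a \<in> carrier X"
    and right_add: "\<lbrakk>a \<in> carrier A; x \<in> carrier X; y \<in> carrier X\<rbrakk>
      \<Longrightarrow> r (x \<oplus>\<^bsub>X\<^esub> y) a = r x a \<oplus>\<^bsub>X\<^esub> r y a"
    and right_smult: "\<lbrakk>a \<in> carrier A; x \<in> carrier X\<rbrakk> \<Longrightarrow> r (c \<odot>\<^bsub>X\<^esub> x) a = c \<odot>\<^bsub>X\<^esub> r x a"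
    and add_right: "\<lbrakk>a \<in> carrier A; b \<in> carrier A; x \<in> carrier X\<rbrakk>
      \<Longrightarrow> r x (a \<oplus>\<^bsub>A\<^esub> b) = r x a \<oplus>\<^bsub>X\<^esub> r x b"
    and smult_right: "\<lbrakk>a \<in> carrier A; x \<in> carrier X\<rbrakk> \<Longrightarrow> r x (c \<odot>\<^bsub>A\<^esub> a) = c \<odot>\<^bsub>X\<^esub> r x a"
    and right_mult: "\<lbrakk>a \<in> carrier A; b \<in> carrier A; x \<in> carrier X\<rbrakk>
      \<Longrightarrow> r x (a \<otimes>\<^bsub>A\<^esub> b) = r (r x a) b"
    and left_right: "\<lbrakk>a \<in> carrier A; b \<in> carrier A; x \<in> carrier X\<rbrakk>
      \<Longrightarrow> l a (r x b) = r (l a x) b"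
    and left_bounded: "\<exists>K. \<forall>a\<in>carrier A. \<forall>x\<in>carrier X. nrm X (l a x) \<le> K * nrm A a * nrm X x"
    and right_bounded: "\<exists>K. \<forall>a\<in>carrier A. \<forall>x\<in>carrier X. nrm X (r x a) \<le> K * nrm A a * nrm X x"

definition bounded_functional :: "'x normed_module \<Rightarrow> ('x \<Rightarrow> complex) \<Rightarrow> bool"
  where "bounded_functional X f \<longleftrightarrow>
    (\<forall>x\<in>carrier X. \<forall>y\<in>carrier X. f (x \<oplus>\<^bsub>X\<^esub> y) = f x + f y) \<and>
    (\<forall>c. \<forall>x\<in>carrier X. f (c \<odot>\<^bsub>X\<^esub> x) = c * f x) \<and>
    (\<exists>K. \<forall>x\<in>carrier X. cmod (f x) \<le> K * nrm X x)"

text \<open>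
  Bounded derivations \<open>D : A \<rightarrow> X*\<close>, where the dual \<open>X*\<close> has the bimodule structure
  \<open>(a\<cdot>f)(x) = f(x\<cdot>a)\<close> and \<open>(f\<cdot>a)(x) = f(a\<cdot>x)\<close>. The Leibniz rule \<open>D(ab) = a\<cdot>D(b) + D(a)\<cdot>b\<close>
  and the bound \<open>\<parallel>D a\<parallel> \<le> K \<parallel>a\<parallel>\<close> are evaluated at the elements of \<open>X\<close>.
\<close>

definition bounded_dual_derivation ::
  "'a normed_module \<Rightarrow> 'x normed_module \<Rightarrow> ('a \<Rightarrow> 'x \<Rightarrow> 'x) \<Rightarrow> ('x \<Rightarrow> 'a \<Rightarrow> 'x)
    \<Rightarrow> ('a \<Rightarrow> 'x \<Rightarrow> complex) \<Rightarrow> bool"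
  where "bounded_dual_derivation A X l r D \<longleftrightarrow>
    (\<forall>a\<in>carrier A. bounded_functional X (D a)) \<and>
    (\<forall>a\<in>carrier A. \<forall>b\<in>carrier A. \<forall>x\<in>carrier X. D (a \<oplus>\<^bsub>A\<^esub> b) x = D a x + D b x) \<and>
    (\<forall>c. \<forall>a\<in>carrier A. \<forall>x\<in>carrier X. D (c \<odot>\<^bsub>A\<^esub> a) x = c * D a x) \<and>
    (\<exists>K. \<forall>a\<in>carrier A. \<forall>x\<in>carrier X. cmod (D a x) \<le> K * nrm A a * nrm X x) \<and>
    (\<forall>a\<in>carrier A. \<forall>b\<in>carrier A. \<forall>x\<in>carrier X.
      D (a \<otimes>\<^bsub>A\<^esub> b) x = D b (r x a) + D a (l b x))"

definition inner_dual_derivation ::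
  "'a normed_module \<Rightarrow> 'x normed_module \<Rightarrow> ('a \<Rightarrow> 'x \<Rightarrow> 'x) \<Rightarrow> ('x \<Rightarrow> 'a \<Rightarrow> 'x)
    \<Rightarrow> ('a \<Rightarrow> 'x \<Rightarrow> complex) \<Rightarrow> bool"
  where "inner_dual_derivation A X l r D \<longleftrightarrow>
    (\<exists>f. bounded_functional X f \<and>
      (\<forall>a\<in>carrier A. \<forall>x\<in>carrier X. D a x = f (r x a) - f (l a x)))"

text \<open>
  Johnson's definition: every bounded derivation into a dual Banach bimodule is inner.
  HOL cannot quantify over types inside a definition, so the bimodules range over all carriers
  in the type of the elements of \<open>A\<close>. For a Banach algebra \<open>A\<close> this loses nothing. If \<open>A\<close> is
  zero, every derivation on it is zero. Otherwise a closed sub-bimodule of an arbitrary Banach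
  bimodule that is generated by countably many elements has at most the cardinality of \<open>A\<close>
  (as \<open>A\<close> has as many sequences as elements), so it has a copy in this type. If the
  restrictions of \<open>D\<close> to all such sub-bimodules are inner, then they are implemented by
  functionals of uniformly bounded norm (otherwise join countably many offending sub-bimodules),
  and weak* compactness of balls gives a functional that implements \<open>D\<close> itself.
\<close>

definition amenable :: "'a normed_module \<Rightarrow> bool"
  where "amenable A \<longleftrightarrow>
    (\<forall>(X :: 'a normed_module) l r D.
      banach_bimodule A X l r \<longrightarrow> bounded_dual_derivation A X l r D \<longrightarrow>
      inner_dual_derivation A X l r D)"

end

theory Submission
  imports Defs "HOL-Probability.Probability_Measure"
begin

text \<open>
  Choose \<open>\<pi>\<close> with \<open>0 < \<bar>\<pi>\<bar> < 1\<close> and let \<open>x\<^sub>n\<close> be the group element with vector part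
  \<open>(\<pi>\<^sup>n, \<dots>, \<pi>\<^sup>n)\<close> and trivial matrix part. For \<open>u = \<langle>\<lambda>(\<cdot>)\<xi>, \<eta>\<rangle>\<close> central, \<open>u(x\<^sub>n)\<close> has variation
  \<open>\<Sum>\<^sub>n \<bar>u(x\<^sub>n\<^sub>+\<^sub>1) - u(x\<^sub>n)\<bar> \<le> 3 \<parallel>\<xi>\<parallel> \<parallel>\<eta>\<parallel>\<close>, so that \<open>D u y = \<Sum>\<^sub>n (u(x\<^sub>n\<^sub>+\<^sub>1) - u(x\<^sub>n)) y\<^sub>n\<close> defines a
  bounded derivation into the dual of the bimodule of bounded sequences, on which \<open>u\<close> acts by
  \<open>u(x\<^sub>n)\<close> from the left and by \<open>u(x\<^sub>n\<^sub>+\<^sub>1)\<close> from the right. A functional implementing \<open>D\<close> would take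
  the value 1 on every unit vector, because the indicator functions of the congruence subgroups
  separate \<open>x\<^sub>n\<close> from \<open>x\<^sub>n\<^sub>+\<^sub>1\<close>; hence it would be unbounded.

  For the variation bound, let \<open>V\<^sub>n = \<lambda>(x\<^sub>n)\<close>. By the parallelogram law the vectors
  \<open>(1 - V\<^sub>n)/2 \<cdot> (1 + V\<^sub>n\<^sub>+\<^sub>1)/2 \<cdots> (1 + V\<^sub>N\<^sub>-\<^sub>1)/2 \<cdot> \<xi>\<close> have square norms adding up to at most \<open>\<parallel>\<xi>\<parallel>\<^sup>2\<close>. As \<open>u\<close> only
  depends on the absolute value along the diagonal vectors (conjugate by scalar matrices), the
  inner products of these vectors with their analogues for \<open>\<eta>\<close> are increments \<open>m\<^sub>n\<^sub>+\<^sub>1 - m\<^sub>n\<close> of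
  a sequence with \<open>u(x\<^sub>n) = 2 m\<^sub>n - m\<^sub>n\<^sub>+\<^sub>1\<close>.
\<close>

no_notation subset_mset (infix "<#" 50)

section \<open>A criterion for non-amenability\<close>

definition bounded_functions :: "('g \<Rightarrow> complex) normed_module"
  where "bounded_functions =
    \<lparr>carrier = {y. bounded (range y)}, mult = (\<lambda>y z p. y p * z p), one = (\<lambda>p. 1),
     zero = (\<lambda>p. 0), add = (\<lambda>y z p. y p + z p), smult = (\<lambda>c y p. c * y p),
     nrm = (\<lambda>y. SUP p. cmod (y p))\<rparr>"

lemma carrier_bounded_functions:
  "y \<in> carrier bounded_functions \<longleftrightarrow> (\<exists>C. \<forall>p. cmod (y p) \<le> C)"
  by (auto simp: bounded_functions_def bounded_iff)

lemma norm_le_nrm_bounded_functions: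
  assumes "y \<in> carrier bounded_functions"
  shows "cmod (y p) \<le> nrm bounded_functions y"
proof -
  have "bdd_above (range (\<lambda>p. cmod (y p)))"
    using assms by (auto simp: carrier_bounded_functions bdd_above_def)
  then show ?thesis
    by (auto simp: bounded_functions_def intro: cSUP_upper)
qed

lemma nrm_bounded_functions_le:
  assumes "\<And>p. cmod (y p) \<le> C"
  shows "nrm bounded_functions y \<le> C"
  using assms by (auto simp: bounded_functions_def intro: cSUP_least)

lemma nrm_bounded_functions_nonneg:
  assumes "y \<in> carrier bounded_functions"
  shows "nrm bounded_functions y \<ge> 0"
  using norm_le_nrm_bounded_functions[OF assms] norm_ge_zero order_trans by blast

lemma bounded_functions_simps [simp]:
  "zero bounded_functions = (\<lambda>p. 0)"
  "add bounded_functions y z = (\<lambda>p. y p + z p)"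
  "smult bounded_functions c y = (\<lambda>p. c * y p)"
  by (simp_all add: bounded_functions_def)

lemma bounded_functions_add_closed:
  assumes "y \<in> carrier bounded_functions" "z \<in> carrier bounded_functions"
  shows "(\<lambda>p. y p + z p) \<in> carrier bounded_functions"
proof -
  obtain C D where "\<forall>p. cmod (y p) \<le> C" "\<forall>p. cmod (z p) \<le> D"
    using assms unfolding carrier_bounded_functions by blast
  then have "\<forall>p. cmod (y p + z p) \<le> C + D"
    by (meson add_mono norm_triangle_ineq order_trans)
  then show ?thesis unfolding carrier_bounded_functions by blast
qed

text \<open>Constant multipliers give scalar multiples and negatives; non-constant ones give the two
  module actions of the criterion below.\<close>

lemma bounded_functions_mult_closed:
  assumes "\<And>p. cmod (c p) \<le> C" "y \<in> carrier bounded_functions"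
  shows "(\<lambda>p. c p * y p) \<in> carrier bounded_functions"
proof -
  have "cmod (c p * y p) \<le> C * nrm bounded_functions y" for p
    unfolding norm_mult using assms(1)[of p] norm_le_nrm_bounded_functions[OF assms(2), of p]
    by (intro mult_mono) (auto intro: order_trans[OF norm_ge_zero])
  then show ?thesis unfolding carrier_bounded_functions by blast
qed

lemma nrm_bounded_functions_mult:
  assumes "\<And>p. cmod (c p) \<le> C" "y \<in> carrier bounded_functions"
  shows "nrm bounded_functions (\<lambda>p. c p * y p) \<le> C * nrm bounded_functions y"
proof (rule nrm_bounded_functions_le)
  fix p show "cmod (c p * y p) \<le> C * nrm bounded_functions y"
    unfolding norm_mult using assms(1)[of p] norm_le_nrm_bounded_functions[OF assms(2), of p]
    by (intro mult_mono) (auto intro: order_trans[OF norm_ge_zero])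
qed

lemma zero_in_bounded_functions: "(\<lambda>p. 0) \<in> carrier bounded_functions"
  unfolding carrier_bounded_functions by auto

lemma cring_complex_ring: "cring complex_ring"
proof (rule cringI)
  show "abelian_group complex_ring"
  proof (rule abelian_groupI)
    fix x assume "x \<in> carrier complex_ring"
    show "\<exists>y\<in>carrier complex_ring. y \<oplus>\<^bsub>complex_ring\<^esub> x = \<zero>\<^bsub>complex_ring\<^esub>"
      by (rule bexI[of _ "- x"]) (auto simp: complex_ring_def)
  qed (auto simp: complex_ring_def algebra_simps)
  show "Group.comm_monoid complex_ring"
    by (rule comm_monoidI) (auto simp: complex_ring_def)
qed (auto simp: complex_ring_def algebra_simps)

lemma module_bounded_functions: "Module.module complex_ring bounded_functions"
proof (rule module.intro)
  show "cring complex_ring" by (rule cring_complex_ring)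
  show "abelian_group (bounded_functions :: ('g \<Rightarrow> complex) normed_module)"
  proof (rule abelian_groupI)
    fix y :: "'g \<Rightarrow> complex" assume "y \<in> carrier bounded_functions"
    then have "(\<lambda>p. (- 1) * y p) \<in> carrier bounded_functions"
      by (intro bounded_functions_mult_closed[where C = 1]) auto
    then show "\<exists>z\<in>carrier bounded_functions. z \<oplus>\<^bsub>bounded_functions\<^esub> y = \<zero>\<^bsub>bounded_functions\<^esub>"
      by (intro bexI) auto
  qed (auto simp: bounded_functions_add_closed zero_in_bounded_functions algebra_simps)
  show "module_axioms complex_ring (bounded_functions :: ('g \<Rightarrow> complex) normed_module)"
    by (rule module_axioms.intro)
      (auto simp: complex_ring_def algebra_simps intro!: bounded_functions_mult_closed)
qed

text \<open>Subtraction in the record is the abstract one, through the additive inverse of the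
  group, so that inverse has to be identified as multiplication by -1.\<close>

lemma minus_bounded_functions:
  assumes "y \<in> carrier bounded_functions" "z \<in> carrier bounded_functions"
  shows "y \<ominus>\<^bsub>bounded_functions\<^esub> z = (\<lambda>p. y p - z p)"
proof -
  interpret Module.module complex_ring bounded_functions by (rule module_bounded_functions)
  have "\<ominus>\<^bsub>bounded_functions\<^esub> z = (\<lambda>p. (-1) * z p)"
  proof (rule minus_equality)
    show "(\<lambda>p. (- 1) * z p) \<in> carrier bounded_functions"
      using assms(2) by (intro bounded_functions_mult_closed[where C = 1]) auto
  qed (use assms in auto)
  then show ?thesis by (simp add: a_minus_def)
qed

lemma complex_banach_space_bounded_functions: "complex_banach_space bounded_functions"
proof (intro complex_banach_space.intro complex_banach_space_axioms.intro module_bounded_functions)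
  fix y :: "'g \<Rightarrow> complex" assume y: "y \<in> carrier bounded_functions"
  then show "nrm bounded_functions y \<ge> 0" by (rule nrm_bounded_functions_nonneg)
  show "nrm bounded_functions y = 0 \<longleftrightarrow> y = \<zero>\<^bsub>bounded_functions\<^esub>"
  proof
    assume "nrm bounded_functions y = 0"
    then show "y = \<zero>\<^bsub>bounded_functions\<^esub>"
      using norm_le_nrm_bounded_functions[OF y] by (auto simp: fun_eq_iff)
  qed (use y in \<open>auto intro!: antisym nrm_bounded_functions_nonneg nrm_bounded_functions_le\<close>)
  fix c
  show "nrm bounded_functions (c \<odot>\<^bsub>bounded_functions\<^esub> y) = cmod c * nrm bounded_functions y"
  proof (rule antisym)
    show "nrm bounded_functions (c \<odot>\<^bsub>bounded_functions\<^esub> y) \<le> cmod c * nrm bounded_functions y"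
      using y by (auto intro!: nrm_bounded_functions_mult)
    have cy: "(\<lambda>p. c * y p) \<in> carrier bounded_functions"
      using y by (intro bounded_functions_mult_closed) auto
    show "cmod c * nrm bounded_functions y \<le> nrm bounded_functions (c \<odot>\<^bsub>bounded_functions\<^esub> y)"
    proof (cases "c = 0")
      case True
      then show ?thesis using nrm_bounded_functions_nonneg[OF cy] by simp
    next
      case False
      have "nrm bounded_functions y \<le> nrm bounded_functions (\<lambda>p. c * y p) / cmod c"
        using norm_le_nrm_bounded_functions[OF cy] False
        by (intro nrm_bounded_functions_le) (auto simp: field_simps norm_mult)
      then show ?thesis using False by (simp add: field_simps)
    qed
  qed
next
  fix y z :: "'g \<Rightarrow> complex"
  assume *: "y \<in> carrier bounded_functions" "z \<in> carrier bounded_functions"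
  have "cmod (y p + z p) \<le> nrm bounded_functions y + nrm bounded_functions z" for p
    using norm_le_nrm_bounded_functions[OF *(1), of p] norm_le_nrm_bounded_functions[OF *(2), of p]
      norm_triangle_ineq[of "y p" "z p"] by linarith
  then show "nrm bounded_functions (y \<oplus>\<^bsub>bounded_functions\<^esub> z)
      \<le> nrm bounded_functions y + nrm bounded_functions z"
    by (auto intro: nrm_bounded_functions_le)
next
  fix \<sigma> :: "nat \<Rightarrow> 'g \<Rightarrow> complex"
  assume \<sigma>: "\<And>n. \<sigma> n \<in> carrier bounded_functions"
    and cauchy: "\<And>e. e > 0 \<Longrightarrow> \<exists>N. \<forall>m\<ge>N. \<forall>n\<ge>N.
      nrm bounded_functions (\<sigma> m \<ominus>\<^bsub>bounded_functions\<^esub> \<sigma> n) < e"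
  have diff: "\<sigma> m \<ominus>\<^bsub>bounded_functions\<^esub> \<sigma> n = (\<lambda>p. \<sigma> m p - \<sigma> n p)" for m n
    by (rule minus_bounded_functions[OF \<sigma> \<sigma>])
  have diff_carrier: "(\<lambda>p. \<sigma> m p - \<sigma> n p) \<in> carrier bounded_functions" for m n
    using bounded_functions_add_closed[OF \<sigma>[of m] bounded_functions_mult_closed[of "\<lambda>_. -1" 1, OF _ \<sigma>[of n]]]
    by simp
  have ptw: "cmod (\<sigma> m p - \<sigma> n p) \<le> nrm bounded_functions (\<sigma> m \<ominus>\<^bsub>bounded_functions\<^esub> \<sigma> n)" for m n p
    unfolding diff by (rule norm_le_nrm_bounded_functions[OF diff_carrier])
  have "Cauchy (\<lambda>n. \<sigma> n p)" for p
    unfolding Cauchy_def dist_norm by (meson cauchy ptw order_le_less_trans)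
  then have "convergent (\<lambda>n. \<sigma> n p)" for p by (rule Cauchy_convergent)
  then obtain y where y: "\<And>p. (\<lambda>n. \<sigma> n p) \<longlonglongrightarrow> y p"
    unfolding convergent_def by metis
  \<comment> \<open>Let \<open>m\<close> tend to infinity in the Cauchy estimate at a fixed
    \<open>p\<close>. The index \<open>N\<close> does not depend on \<open>p\<close>, so the
    convergence is uniform.\<close>
  have close: "\<exists>N. \<forall>n\<ge>N. \<forall>p. cmod (\<sigma> n p - y p) \<le> e" if "e > 0" for e
  proof -
    obtain N where N: "\<forall>m\<ge>N. \<forall>n\<ge>N. nrm bounded_functions (\<sigma> m \<ominus>\<^bsub>bounded_functions\<^esub> \<sigma> n) < e"
      using cauchy \<open>e > 0\<close> by blast
    have "cmod (\<sigma> n p - y p) \<le> e" if "n \<ge> N" for n p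
    proof (rule Lim_bounded)
      show "(\<lambda>m. cmod (\<sigma> n p - \<sigma> m p)) \<longlonglongrightarrow> cmod (\<sigma> n p - y p)"
        by (intro tendsto_intros y)
      show "\<forall>m\<ge>N. cmod (\<sigma> n p - \<sigma> m p) \<le> e"
        using N that ptw by (meson less_imp_le order_trans)
    qed
    then show ?thesis by blast
  qed
  obtain N where N: "\<And>p. cmod (\<sigma> N p - y p) \<le> 1" using close[of 1] by auto
  have y_carrier: "y \<in> carrier bounded_functions"
  proof -
    obtain C where C: "\<And>p. cmod (\<sigma> N p) \<le> C" using \<sigma>[of N] unfolding carrier_bounded_functions by blast
    have "cmod (y p) \<le> C + 1" for p
      using N[of p] C[of p] norm_triangle_ineq4[of "\<sigma> N p" "\<sigma> N p - y p"] by simp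
    then show ?thesis unfolding carrier_bounded_functions by blast
  qed
  have "(\<lambda>n. nrm bounded_functions (\<sigma> n \<ominus>\<^bsub>bounded_functions\<^esub> y)) \<longlonglongrightarrow> 0"
  proof (rule LIMSEQ_I)
    fix e :: real assume "e > 0"
    \<comment> \<open>Half of \<open>e\<close>, because the supremum inherits only the non-strict
      bound.\<close>
    then obtain N where N: "\<forall>n\<ge>N. \<forall>p. cmod (\<sigma> n p - y p) \<le> e / 2" using close[of "e / 2"] by auto
    have "norm (nrm bounded_functions (\<sigma> n \<ominus>\<^bsub>bounded_functions\<^esub> y) - 0) < e" if "n \<ge> N" for n
    proof -
      have d: "(\<lambda>p. \<sigma> n p - y p) \<in> carrier bounded_functions"
        using N that unfolding carrier_bounded_functions by blast
      have "nrm bounded_functions (\<lambda>p. \<sigma> n p - y p) \<le> e / 2"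
        using N that by (intro nrm_bounded_functions_le) auto
      then show ?thesis
        using nrm_bounded_functions_nonneg[OF d] \<open>e > 0\<close>
        unfolding minus_bounded_functions[OF \<sigma> y_carrier] by auto
    qed
    then show "\<exists>N. \<forall>n\<ge>N. norm (nrm bounded_functions (\<sigma> n \<ominus>\<^bsub>bounded_functions\<^esub> y) - 0) < e" by blast
  qed
  then show "\<exists>y\<in>carrier bounded_functions.
      (\<lambda>n. nrm bounded_functions (\<sigma> n \<ominus>\<^bsub>bounded_functions\<^esub> y)) \<longlonglongrightarrow> 0"
    using y_carrier by blast
qed


text \<open>The product rule for differences, a'b' - ab = a'(b' - b) + (a' - a)b with primes marking
  the next point of the sequence, dictates that the right action evaluates one step ahead of the
  left action. Bounded variation makes the series \<open>D\<close> converge absolutely.\<close>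

lemma not_amenable_if_variation_bounded:
  fixes A :: "('g \<Rightarrow> complex) normed_module" and x :: "nat \<Rightarrow> 'g"
  assumes "inj x"
    and add_A: "\<And>a b. a \<oplus>\<^bsub>A\<^esub> b = (\<lambda>p. a p + b p)"
    and mult_A: "\<And>a b. a \<otimes>\<^bsub>A\<^esub> b = (\<lambda>p. a p * b p)"
    and smult_A: "\<And>c a. c \<odot>\<^bsub>A\<^esub> a = (\<lambda>p. c * a p)"
    and eval_bounded: "\<And>a n. a \<in> carrier A \<Longrightarrow> cmod (a (x n)) \<le> K * nrm A a"
    and variation: "\<And>a n. a \<in> carrier A \<Longrightarrow> (\<Sum>k<n. cmod (a (x (Suc k)) - a (x k))) \<le> K * nrm A a"
    and separating: "\<And>n. \<exists>a\<in>carrier A. a (x (Suc n)) \<noteq> a (x n)"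
  shows "\<not> amenable A"
proof
  \<comment> \<open>\<open>amenable\<close> ranges over bimodules carried by the element type of
    \<open>A\<close>, so bounded sequences are modelled by bounded functions on the whole type
    \<open>'g\<close>; the n-th entry of \<open>y\<close> is \<open>y (x n)\<close>.\<close>
  let ?X = "bounded_functions :: ('g \<Rightarrow> complex) normed_module"
  \<comment> \<open>Off the range of \<open>x\<close> the index \<open>i\<close> is a junk value, but the actions below stay bounded there.\<close>
  define i where "i = inv_into UNIV x"
  have i_x: "i (x n) = n" for n using \<open>inj x\<close> by (simp add: i_def)
  define l where "l = (\<lambda>a y p. a (x (i p)) * y p :: complex)"
  define r where "r = (\<lambda>y a p. a (x (Suc (i p))) * y p :: complex)"
  define D where "D = (\<lambda>a y. \<Sum>n. (a (x (Suc n)) - a (x n)) * y (x n) :: complex)"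
  have summable_variation: "summable (\<lambda>k. cmod (a (x (Suc k)) - a (x k)))"
    and variation_suminf: "(\<Sum>k. cmod (a (x (Suc k)) - a (x k))) \<le> K * nrm A a"
    if "a \<in> carrier A" for a
  proof -
    show "summable (\<lambda>k. cmod (a (x (Suc k)) - a (x k)))"
      by (rule bounded_imp_summable[where B = "K * nrm A a"])
        (use variation[OF that, of "Suc n" for n] in \<open>auto simp: lessThan_Suc_atMost\<close>)
    then show "(\<Sum>k. cmod (a (x (Suc k)) - a (x k))) \<le> K * nrm A a"
      using variation[OF that] by (rule suminf_le_const)
  qed
  have nonneg: "0 \<le> K * nrm A a" if "a \<in> carrier A" for a
    using variation[OF that, of 0] by simp
  have D_norm_le: "norm ((a (x (Suc n)) - a (x n)) * y (x n)) \<le> cmod (a (x (Suc n)) - a (x n)) * nrm ?X y"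
    if "y \<in> carrier ?X" for a y n
    unfolding norm_mult by (intro mult_left_mono norm_le_nrm_bounded_functions that) auto
  have summable_norm_D: "summable (\<lambda>n. norm ((a (x (Suc n)) - a (x n)) * y (x n)))"
    if "a \<in> carrier A" "y \<in> carrier ?X" for a y
  proof (rule summable_comparison_test')
    show "summable (\<lambda>n. cmod (a (x (Suc n)) - a (x n)) * nrm ?X y)"
      by (rule summable_mult2[OF summable_variation[OF that(1)]])
    show "norm (norm ((a (x (Suc n)) - a (x n)) * y (x n))) \<le> cmod (a (x (Suc n)) - a (x n)) * nrm ?X y" if "n \<ge> 0" for n
      using D_norm_le[OF \<open>y \<in> carrier ?X\<close>] by simp
  qed
  have summable_D: "summable (\<lambda>n. (a (x (Suc n)) - a (x n)) * y (x n))"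
    if "a \<in> carrier A" "y \<in> carrier ?X" for a y
    by (rule summable_norm_cancel[OF summable_norm_D[OF that]])
  have D_le: "cmod (D a y) \<le> K * nrm A a * nrm ?X y" if "a \<in> carrier A" "y \<in> carrier ?X" for a y
  proof -
    have "cmod (D a y) \<le> (\<Sum>n. norm ((a (x (Suc n)) - a (x n)) * y (x n)))"
      unfolding D_def by (rule summable_norm[OF summable_norm_D[OF that]])
    also have "\<dots> \<le> (\<Sum>n. cmod (a (x (Suc n)) - a (x n)) * nrm ?X y)"
      by (rule suminf_le[OF D_norm_le[OF that(2)] summable_norm_D[OF that]
            summable_mult2[OF summable_variation[OF that(1)]]])
    also have "\<dots> = (\<Sum>n. cmod (a (x (Suc n)) - a (x n))) * nrm ?X y"
      by (rule suminf_mult2[symmetric, OF summable_variation[OF that(1)]])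
    also have "\<dots> \<le> K * nrm A a * nrm ?X y"
      by (intro mult_right_mono variation_suminf that nrm_bounded_functions_nonneg)
    finally show ?thesis .
  qed
  have l_closed: "l a y \<in> carrier ?X" and r_closed: "r y a \<in> carrier ?X"
    and l_le: "nrm ?X (l a y) \<le> K * nrm A a * nrm ?X y"
    and r_le: "nrm ?X (r y a) \<le> K * nrm A a * nrm ?X y"
    if "a \<in> carrier A" "y \<in> carrier ?X" for a y
    unfolding l_def r_def
    by (rule bounded_functions_mult_closed[OF eval_bounded[OF that(1)] that(2)]
        nrm_bounded_functions_mult[OF eval_bounded[OF that(1)] that(2)])+
  have bimodule: "banach_bimodule A ?X l r"
  proof (intro banach_bimodule.intro banach_bimodule_axioms.intro complex_banach_space_bounded_functions)
    show "\<exists>K. \<forall>a\<in>carrier A. \<forall>y\<in>carrier ?X. nrm ?X (l a y) \<le> K * nrm A a * nrm ?X y"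
      "\<exists>K. \<forall>a\<in>carrier A. \<forall>y\<in>carrier ?X. nrm ?X (r y a) \<le> K * nrm A a * nrm ?X y"
      using l_le r_le by blast+
  qed ((rule l_closed r_closed; assumption) | simp add: l_def r_def add_A mult_A smult_A algebra_simps)+
  have derivation: "bounded_dual_derivation A ?X l r D"
    unfolding bounded_dual_derivation_def
  proof (intro conjI ballI allI)
    fix a assume a: "a \<in> carrier A"
    show "bounded_functional ?X (D a)"
      unfolding bounded_functional_def
    proof (intro conjI ballI allI exI)
      fix y z assume yz: "y \<in> carrier ?X" "z \<in> carrier ?X"
      show "D a (y \<oplus>\<^bsub>?X\<^esub> z) = D a y + D a z"
        by (simp add: D_def distrib_left suminf_add[OF summable_D[OF a yz(1)] summable_D[OF a yz(2)]])
    next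
      fix c y assume y: "y \<in> carrier ?X"
      have "(a (x (Suc n)) - a (x n)) * (c * y (x n)) = c * ((a (x (Suc n)) - a (x n)) * y (x n))" for n
        by (simp add: algebra_simps)
      then show "D a (c \<odot>\<^bsub>?X\<^esub> y) = c * D a y"
        unfolding D_def by (simp only: bounded_functions_simps suminf_mult[OF summable_D[OF a y]])
    next
      fix y assume "y \<in> carrier ?X"
      then show "cmod (D a y) \<le> K * nrm A a * nrm ?X y" by (rule D_le[OF a])
    qed
    fix y assume y: "y \<in> carrier ?X"
    fix b assume b: "b \<in> carrier A"
    have "(a (x (Suc n)) + b (x (Suc n)) - (a (x n) + b (x n))) * y (x n)
        = (a (x (Suc n)) - a (x n)) * y (x n) + (b (x (Suc n)) - b (x n)) * y (x n)" for n
      by (simp add: algebra_simps)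
    then show "D (a \<oplus>\<^bsub>A\<^esub> b) y = D a y + D b y"
      unfolding D_def by (simp only: add_A suminf_add[OF summable_D[OF a y] summable_D[OF b y]])
    have "D b (r y a) + D a (l b y)
        = (\<Sum>n. (b (x (Suc n)) - b (x n)) * r y a (x n) + (a (x (Suc n)) - a (x n)) * l b y (x n))"
      unfolding D_def by (rule suminf_add[OF summable_D[OF b r_closed[OF a y]] summable_D[OF a l_closed[OF b y]]])
    also have "\<dots> = D (a \<otimes>\<^bsub>A\<^esub> b) y"
      unfolding D_def by (simp add: mult_A l_def r_def i_x algebra_simps)
    finally show "D (a \<otimes>\<^bsub>A\<^esub> b) y = D b (r y a) + D a (l b y)" ..
  next
    fix c a y assume ay: "a \<in> carrier A" "y \<in> carrier ?X"
    have "(c * a (x (Suc n)) - c * a (x n)) * y (x n) = c * ((a (x (Suc n)) - a (x n)) * y (x n))" for n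
      by (simp add: algebra_simps)
    then show "D (c \<odot>\<^bsub>A\<^esub> a) y = c * D a y"
      unfolding D_def by (simp only: smult_A suminf_mult[OF summable_D[OF ay]])
  next
    show "\<exists>K. \<forall>a\<in>carrier A. \<forall>y\<in>carrier ?X. cmod (D a y) \<le> K * nrm A a * nrm ?X y"
      using D_le by blast
  qed
  assume "amenable A"
  then have "inner_dual_derivation A ?X l r D"
    using bimodule derivation unfolding amenable_def by blast
  then obtain f C where f: "bounded_functional ?X f"
    and inner: "\<And>a y. a \<in> carrier A \<Longrightarrow> y \<in> carrier ?X \<Longrightarrow> D a y = f (r y a) - f (l a y)"
    and C: "\<And>y. y \<in> carrier ?X \<Longrightarrow> cmod (f y) \<le> C * nrm ?X y"
    unfolding inner_dual_derivation_def bounded_functional_def by blast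
  have f_add: "f (\<lambda>p. y p + z p) = f y + f z" and f_smult: "f (\<lambda>p. c * y p) = c * f y"
    if "y \<in> carrier ?X" "z \<in> carrier ?X" for y z c
    using f that unfolding bounded_functional_def by auto
  define \<delta> where "\<delta> = (\<lambda>n p. of_bool (p = x n) :: complex)"
  define s where "s = (\<lambda>n p. of_bool (p \<in> x ` {..<n}) :: complex)"
  have \<delta>: "\<delta> n \<in> carrier ?X" and s: "s n \<in> carrier ?X" for n
    unfolding carrier_bounded_functions \<delta>_def s_def by (auto intro!: exI[of _ 1])
  \<comment> \<open>On a unit vector both actions are scalar, and their scalars differ by
    \<open>a (x (Suc n)) - a (x n)\<close>, which is also the value of \<open>D a\<close>. A
    separating \<open>a\<close> allows this factor to be cancelled.\<close>
  have f_\<delta>: "f (\<delta> n) = 1" for n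
  proof -
    obtain a where a: "a \<in> carrier A" "a (x (Suc n)) \<noteq> a (x n)" using separating by blast
    have r_\<delta>: "r (\<delta> n) a = (\<lambda>p. a (x (Suc n)) * \<delta> n p)" and l_\<delta>: "l a (\<delta> n) = (\<lambda>p. a (x n) * \<delta> n p)"
      by (auto simp: r_def l_def \<delta>_def i_x fun_eq_iff)
    have "D a (\<delta> n) = (\<Sum>k\<in>{n}. (a (x (Suc k)) - a (x k)) * \<delta> n (x k))"
      unfolding D_def using \<open>inj x\<close> by (intro suminf_finite) (auto simp: \<delta>_def inj_eq)
    then have "D a (\<delta> n) = a (x (Suc n)) - a (x n)" by (simp add: \<delta>_def)
    moreover have "D a (\<delta> n) = (a (x (Suc n)) - a (x n)) * f (\<delta> n)"
      unfolding inner[OF a(1) \<delta>] r_\<delta> l_\<delta> by (simp add: f_smult[OF \<delta> \<delta>] left_diff_distrib)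
    ultimately show ?thesis using a(2) by simp
  qed
  \<comment> \<open>The indicator of the first \<open>n\<close> points is a sum of \<open>n\<close>
    unit vectors, while its supremum norm stays at most 1.\<close>
  have f_s: "f (s n) = of_nat n" for n
  proof (induction n)
    case 0
    show ?case using f_smult[OF s s, of 0 0] by (simp add: s_def)
  next
    case (Suc n)
    have "s (Suc n) = (\<lambda>p. s n p + \<delta> n p)"
      using \<open>inj x\<close> by (auto simp: s_def \<delta>_def fun_eq_iff lessThan_Suc inj_eq)
    then show ?case using f_add[OF s \<delta>, of n n] Suc f_\<delta> by simp
  qed
  have "real n \<le> \<bar>C\<bar>" for n
  proof -
    have "nrm ?X (s n) \<le> 1" by (rule nrm_bounded_functions_le) (simp add: s_def)
    then have "C * nrm ?X (s n) \<le> \<bar>C\<bar> * 1"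
      using nrm_bounded_functions_nonneg[OF s, of n] by (intro mult_mono) auto
    then show ?thesis using C[OF s, of n] by (simp add: f_s)
  qed
  moreover obtain n where "\<bar>C\<bar> < real n" using reals_Archimedean2 by blast
  ultimately show False using leD by blast
qed

section \<open>Coefficients along a copy of the integers\<close>

text \<open>The infimum over \<open>s\<close> of the right-hand side is \<open>a * b\<close>. This
  recovers a product of norms from a mean of squares, the form in which the estimates below add
  up.\<close>

lemma le_mult_if_le_scaled_sum:
  fixes a b t :: real
  assumes "a \<ge> 0" "b \<ge> 0" and le: "\<And>s. s > 0 \<Longrightarrow> t \<le> ((s * a)\<^sup>2 + (b / s)\<^sup>2) / 2"
  shows "t \<le> a * b"
proof -
  have "t \<le> (a + e) * (b + e)" if "e > 0" for e
  proof -
    \<comment> \<open>The minimiser of the mean of squares for \<open>a + e\<close> and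
      \<open>b + e\<close>. The shift by \<open>e\<close> keeps it positive and finite when
      \<open>a\<close> or \<open>b\<close> vanishes.\<close>
    define s where "s = sqrt ((b + e) / (a + e))"
    have ae: "a + e > 0" and be: "b + e > 0" using assms(1,2) that by auto
    then have s: "s > 0" "s\<^sup>2 = (b + e) / (a + e)" by (auto simp: s_def)
    have "t \<le> ((s * (a + e))\<^sup>2 + ((b + e) / s)\<^sup>2) / 2"
      using assms(1,2) s(1) that
      by (intro order_trans[OF le[OF s(1)]] divide_right_mono add_mono power_mono mult_left_mono) auto
    also have "\<dots> = (a + e) * (b + e)"
    proof -
      have "(s * (a + e))\<^sup>2 = (a + e) * (b + e)"
        unfolding power_mult_distrib s(2) using ae by (simp add: power2_eq_square)
      moreover have "((b + e) / s)\<^sup>2 = (a + e) * (b + e)"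
        unfolding power_divide s(2) using ae be by (simp add: power2_eq_square)
      ultimately show ?thesis by simp
    qed
    finally show ?thesis .
  qed
  moreover have "((\<lambda>e. (a + e) * (b + e)) \<longlongrightarrow> (a + 0) * (b + 0)) (at_right 0)"
    by (intro tendsto_intros)
  ultimately show ?thesis
    by (intro tendsto_lowerbound[of "\<lambda>e. (a + e) * (b + e)" _ "at_right 0"])
      (auto simp: eventually_at_right_less intro: eventually_mono[OF eventually_at_right_less])
qed

lemma (in Group.group) vimage_translation:
  assumes "g \<in> carrier G" "A \<subseteq> carrier G"
  shows "(\<lambda>y. g \<otimes> y) -` A \<inter> carrier G = inv g <# A"
proof -
  have "y = inv g \<otimes> (g \<otimes> y)" if "y \<in> carrier G" for y
    using assms that by (simp add: m_assoc[symmetric])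
  then show ?thesis
    using assms by (auto simp: l_coset_def m_assoc[symmetric] subset_iff)
qed

section \<open>Translations and coefficients of square-integrable functions\<close>

locale haar_group = Group.group G for G :: "('g::metric_space, 'm) monoid_scheme" (structure) and \<mu> +
  assumes haar_measure: "is_haar_measure G \<mu>"
    and translation_measurable: "g \<in> carrier G \<Longrightarrow> (\<lambda>y. g \<otimes> y) \<in> measurable \<mu> \<mu>"
begin

lemma space_eq: "space \<mu> = carrier G"
  using haar_measure by (simp add: is_haar_measure_def)

sublocale prob_space \<mu>
  using haar_measure by (auto simp: is_haar_measure_def intro!: prob_spaceI)

lemma emeasure_l_coset: "g \<in> carrier G \<Longrightarrow> A \<in> sets \<mu> \<Longrightarrow> emeasure \<mu> (g <# A) = emeasure \<mu> A"
  using haar_measure by (simp add: is_haar_measure_def)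

text \<open>The preimage of \<open>A\<close> under left multiplication by \<open>inv g\<close> is
  \<open>g <# A\<close>, so left invariance of the measure applies. The invariance of integrals
  follows from this.\<close>

lemma distr_translation:
  assumes "g \<in> carrier G"
  shows "distr \<mu> \<mu> (\<lambda>y. inv g \<otimes> y) = \<mu>"
proof (rule measure_eqI)
  fix A assume "A \<in> sets (distr \<mu> \<mu> (\<lambda>y. inv g \<otimes> y))"
  then have A: "A \<in> sets \<mu>" by simp
  then have "A \<subseteq> carrier G" using sets.sets_into_space space_eq by auto
  then show "emeasure (distr \<mu> \<mu> (\<lambda>y. inv g \<otimes> y)) A = emeasure \<mu> A"
    using assms A by (simp add: emeasure_distr translation_measurable space_eq
        vimage_translation[OF inv_closed] emeasure_l_coset)
qed simp

lemma integral_translation: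
  fixes f :: "'g \<Rightarrow> 'b::{banach, second_countable_topology}"
  assumes "g \<in> carrier G" "f \<in> borel_measurable \<mu>"
  shows "(\<integral>y. f (inv g \<otimes> y) \<partial>\<mu>) = (\<integral>y. f y \<partial>\<mu>)"
  using integral_distr[OF translation_measurable[of "inv g"] assms(2)] distr_translation[OF assms(1)] assms(1)
  by simp

lemma integrable_translation:
  fixes f :: "'g \<Rightarrow> 'b::{banach, second_countable_topology}"
  assumes "g \<in> carrier G" "integrable \<mu> f"
  shows "integrable \<mu> (\<lambda>y. f (inv g \<otimes> y))"
  using integrable_distr[OF translation_measurable[of "inv g"], of f] distr_translation[OF assms(1)] assms
  by simp

definition inner_L2 :: "('g \<Rightarrow> complex) \<Rightarrow> ('g \<Rightarrow> complex) \<Rightarrow> complex"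
  where "inner_L2 \<xi> \<eta> = (\<integral>y. \<xi> y * cnj (\<eta> y) \<partial>\<mu>)"

text \<open>The operator \<lambda>(g) of the left regular representation.\<close>

definition translate :: "'g \<Rightarrow> ('g \<Rightarrow> complex) \<Rightarrow> 'g \<Rightarrow> complex"
  where "translate g \<xi> = (\<lambda>y. \<xi> (inv g \<otimes> y))"

lemma L2_D:
  assumes "\<xi> \<in> L2 \<mu>"
  shows L2_measurable: "\<xi> \<in> borel_measurable \<mu>" and L2_integrable: "integrable \<mu> (\<lambda>y. (cmod (\<xi> y))\<^sup>2)"
  using assms by (auto simp: L2_def)

lemma L2_norm_nonneg: "L2_norm \<mu> \<xi> \<ge> 0"
  by (simp add: L2_norm_def)

lemma L2_norm_power2: "(L2_norm \<mu> \<xi>)\<^sup>2 = (\<integral>y. (cmod (\<xi> y))\<^sup>2 \<partial>\<mu>)"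
  by (simp add: L2_norm_def)

lemma L2_scale:
  assumes "\<xi> \<in> L2 \<mu>"
  shows "(\<lambda>y. c * \<xi> y) \<in> L2 \<mu>"
  using L2_D[OF assms] by (auto simp: L2_def norm_mult power_mult_distrib)

lemma L2_norm_scale: "L2_norm \<mu> (\<lambda>y. c * \<xi> y) = cmod c * L2_norm \<mu> \<xi>"
  by (simp add: L2_norm_def norm_mult power_mult_distrib real_sqrt_mult)

lemma cmod_add_power2_le: "(cmod (x + y))\<^sup>2 \<le> 2 * (cmod x)\<^sup>2 + 2 * (cmod y)\<^sup>2"
proof -
  have "(cmod (x + y))\<^sup>2 + (cmod (x - y))\<^sup>2 = 2 * (cmod x)\<^sup>2 + 2 * (cmod y)\<^sup>2"
    unfolding cmod_power2 by (simp add: power2_eq_square algebra_simps)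
  then show ?thesis using zero_le_power2[of "cmod (x - y)"] by linarith
qed

lemma L2_add:
  assumes "\<xi> \<in> L2 \<mu>" "\<eta> \<in> L2 \<mu>"
  shows "(\<lambda>y. \<xi> y + \<eta> y) \<in> L2 \<mu>"
proof -
  have meas: "(\<lambda>y. \<xi> y + \<eta> y) \<in> borel_measurable \<mu>"
    using L2_measurable[OF assms(1)] L2_measurable[OF assms(2)] by simp
  have "integrable \<mu> (\<lambda>y. (cmod (\<xi> y + \<eta> y))\<^sup>2)"
  proof (rule Bochner_Integration.integrable_bound)
    show "integrable \<mu> (\<lambda>y. 2 * (cmod (\<xi> y))\<^sup>2 + 2 * (cmod (\<eta> y))\<^sup>2)"
      using L2_integrable[OF assms(1)] L2_integrable[OF assms(2)] by simp
    show "AE y in \<mu>. norm ((cmod (\<xi> y + \<eta> y))\<^sup>2) \<le> norm (2 * (cmod (\<xi> y))\<^sup>2 + 2 * (cmod (\<eta> y))\<^sup>2)"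
      using cmod_add_power2_le by auto
  qed (use meas in measurable)
  with meas show ?thesis by (simp add: L2_def)
qed

lemma L2_translate:
  assumes "g \<in> carrier G" "\<xi> \<in> L2 \<mu>"
  shows "translate g \<xi> \<in> L2 \<mu>"
  using measurable_compose[OF translation_measurable[of "inv g"] L2_measurable[OF assms(2)]]
    integrable_translation[OF assms(1) L2_integrable[OF assms(2)]] assms(1)
  by (auto simp: L2_def translate_def)

text \<open>The pointwise inequality between geometric and arithmetic mean gives integrability and
  bound at once. A mean of squares is kept in place of the Cauchy-Schwarz product because the
  parallelogram law splits squares exactly.\<close>

lemma integrable_inner_L2:
  assumes "\<xi> \<in> L2 \<mu>" "\<eta> \<in> L2 \<mu>"
  shows "integrable \<mu> (\<lambda>y. \<xi> y * cnj (\<eta> y))"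
    and "cmod (inner_L2 \<xi> \<eta>) \<le> ((L2_norm \<mu> \<xi>)\<^sup>2 + (L2_norm \<mu> \<eta>)\<^sup>2) / 2"
proof -
  have int: "integrable \<mu> (\<lambda>y. ((cmod (\<xi> y))\<^sup>2 + (cmod (\<eta> y))\<^sup>2) / 2)"
    using L2_integrable[OF assms(1)] L2_integrable[OF assms(2)] by simp
  have le: "cmod (\<xi> y * cnj (\<eta> y)) \<le> ((cmod (\<xi> y))\<^sup>2 + (cmod (\<eta> y))\<^sup>2) / 2" for y
    using sum_squares_bound[of "cmod (\<xi> y)" "cmod (\<eta> y)"] by (simp add: norm_mult)
  show *: "integrable \<mu> (\<lambda>y. \<xi> y * cnj (\<eta> y))"
  proof (rule Bochner_Integration.integrable_bound[OF int])
    show "AE y in \<mu>. norm (\<xi> y * cnj (\<eta> y)) \<le> norm (((cmod (\<xi> y))\<^sup>2 + (cmod (\<eta> y))\<^sup>2) / 2)"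
      using le by simp
    have "(\<lambda>y. cnj (\<eta> y)) \<in> borel_measurable \<mu>"
      using L2_measurable[OF assms(2)]
      by (rule measurable_compose) (intro borel_measurable_continuous_onI continuous_intros)
    then show "(\<lambda>y. \<xi> y * cnj (\<eta> y)) \<in> borel_measurable \<mu>"
      using L2_measurable[OF assms(1)] by measurable
  qed
  have "cmod (inner_L2 \<xi> \<eta>) \<le> (\<integral>y. cmod (\<xi> y * cnj (\<eta> y)) \<partial>\<mu>)"
    unfolding inner_L2_def by (rule integral_norm_bound)
  also have "\<dots> \<le> (\<integral>y. ((cmod (\<xi> y))\<^sup>2 + (cmod (\<eta> y))\<^sup>2) / 2 \<partial>\<mu>)"
    by (intro integral_mono integrable_norm * int le)
  also have "\<dots> = ((L2_norm \<mu> \<xi>)\<^sup>2 + (L2_norm \<mu> \<eta>)\<^sup>2) / 2"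
    unfolding L2_norm_power2 using L2_integrable[OF assms(1)] L2_integrable[OF assms(2)] by simp
  finally show "cmod (inner_L2 \<xi> \<eta>) \<le> ((L2_norm \<mu> \<xi>)\<^sup>2 + (L2_norm \<mu> \<eta>)\<^sup>2) / 2" .
qed

text \<open>The operator \<open>(1 + s \<lambda>(g)) / 2\<close>, applied with \<open>s = 1\<close>
  for averaging and \<open>s = - 1\<close> for the complementary part.\<close>

definition half_sum :: "complex \<Rightarrow> 'g \<Rightarrow> ('g \<Rightarrow> complex) \<Rightarrow> 'g \<Rightarrow> complex"
  where "half_sum s g \<xi> = (\<lambda>y. (1 / 2) * (\<xi> y + s * translate g \<xi> y))"

lemma L2_half_sum:
  assumes "g \<in> carrier G" "\<xi> \<in> L2 \<mu>"
  shows "half_sum s g \<xi> \<in> L2 \<mu>"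
  unfolding half_sum_def by (intro L2_scale L2_add L2_translate assms)

text \<open>Parallelogram law for \<xi> and its translate, which have equal norms.\<close>

lemma L2_norm_half_sum:
  assumes "g \<in> carrier G" "\<xi> \<in> L2 \<mu>"
  shows "(L2_norm \<mu> (half_sum 1 g \<xi>))\<^sup>2 + (L2_norm \<mu> (half_sum (- 1) g \<xi>))\<^sup>2 = (L2_norm \<mu> \<xi>)\<^sup>2"
proof -
  have parallelogram: "(cmod ((1 / 2) * (x + 1 * y)))\<^sup>2 + (cmod ((1 / 2) * (x + (- 1) * y)))\<^sup>2
      = ((cmod x)\<^sup>2 + (cmod y)\<^sup>2) / 2" for x y :: complex
    unfolding cmod_power2 by (simp add: power2_eq_square field_simps)
  note int = L2_integrable[OF L2_half_sum[OF assms]] L2_integrable[OF assms(2)]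
    L2_integrable[OF L2_translate[OF assms]]
  have "(L2_norm \<mu> (half_sum 1 g \<xi>))\<^sup>2 + (L2_norm \<mu> (half_sum (- 1) g \<xi>))\<^sup>2
      = (\<integral>y. (cmod (half_sum 1 g \<xi> y))\<^sup>2 + (cmod (half_sum (- 1) g \<xi> y))\<^sup>2 \<partial>\<mu>)"
    unfolding L2_norm_power2 by (rule Bochner_Integration.integral_add[symmetric, OF int(1) int(1)])
  also have "\<dots> = (\<integral>y. ((cmod (\<xi> y))\<^sup>2 + (cmod (translate g \<xi> y))\<^sup>2) / 2 \<partial>\<mu>)"
    unfolding half_sum_def parallelogram ..
  also have "\<dots> = ((L2_norm \<mu> \<xi>)\<^sup>2 + (\<integral>y. (cmod (translate g \<xi> y))\<^sup>2 \<partial>\<mu>)) / 2"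
    unfolding L2_norm_power2 using int by simp
  also have "(\<integral>y. (cmod (translate g \<xi> y))\<^sup>2 \<partial>\<mu>) = (L2_norm \<mu> \<xi>)\<^sup>2"
    unfolding translate_def L2_norm_power2
    using L2_measurable[OF assms(2)] by (intro integral_translation[OF assms(1)]) measurable
  finally show ?thesis by simp
qed

text \<open>Expand into four inner products. Since \<lambda>(g) is unitary and commutes with
  \<lambda>(h), the two unmixed terms agree, and the mixed ones are coefficients at
  \<open>h \<otimes> g\<close> and \<open>h \<otimes> inv g\<close>.\<close>

lemma inner_L2_half_sum:
  assumes g: "g \<in> carrier G" and h: "h \<in> carrier G" and comm: "g \<otimes> h = h \<otimes> g"
    and s: "s = 1 \<or> s = - 1" and \<xi>: "\<xi> \<in> L2 \<mu>" and \<eta>: "\<eta> \<in> L2 \<mu>"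
  shows "inner_L2 (translate h (half_sum s g \<xi>)) (half_sum s g \<eta>)
    = (2 * inner_L2 (translate h \<xi>) \<eta> + s * inner_L2 (translate (h \<otimes> g) \<xi>) \<eta>
        + s * inner_L2 (translate (h \<otimes> inv g) \<xi>) \<eta>) / 4"
proof -
  let ?F = "\<lambda>\<xi> \<eta> y. \<xi> y * cnj (\<eta> y)"
  have hg: "translate (h \<otimes> g) \<xi> y = \<xi> (inv g \<otimes> (inv h \<otimes> y))" if "y \<in> carrier G" for y
    using that g h by (simp add: translate_def inv_mult_group m_assoc)
  have hg': "translate (h \<otimes> inv g) \<xi> (inv g \<otimes> y) = translate h \<xi> y" if "y \<in> carrier G" for y
  proof -
    have "inv (h \<otimes> inv g) \<otimes> (inv g \<otimes> y) = g \<otimes> (inv h \<otimes> inv g) \<otimes> y"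
      using that g h by (simp add: inv_mult_group m_assoc)
    also have "inv h \<otimes> inv g = inv g \<otimes> inv h"
      using g h comm by (simp add: inv_mult_group[symmetric])
    also have "g \<otimes> (inv g \<otimes> inv h) \<otimes> y = inv h \<otimes> y"
      using that g h by (simp add: m_assoc[symmetric])
    finally show ?thesis by (simp add: translate_def)
  qed
  have hg'': "inv g \<otimes> (inv h \<otimes> y) = inv h \<otimes> (inv g \<otimes> y)" if "y \<in> carrier G" for y
    using that g h comm by (simp add: m_assoc[symmetric] inv_mult_group[symmetric])
  note L2s = L2_translate[OF h \<xi>] L2_translate[OF m_closed[OF h g] \<xi>]
    L2_translate[OF m_closed[OF h inv_closed[OF g]] \<xi>]
  note int = integrable_inner_L2(1)[OF L2s(1) \<eta>] integrable_inner_L2(1)[OF L2s(2) \<eta>]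
    integrable_translation[OF g integrable_inner_L2(1)[OF L2s(3) \<eta>]]
    integrable_translation[OF g integrable_inner_L2(1)[OF L2s(1) \<eta>]]
  \<comment> \<open>The two terms with a translated \<eta> are written as integrands evaluated at
    \<open>inv g \<otimes> y\<close>, so that invariance of the integral removes the shift.\<close>
  have "inner_L2 (translate h (half_sum s g \<xi>)) (half_sum s g \<eta>)
    = (\<integral>y. (1 / 4) * (?F (translate h \<xi>) \<eta> y + s * ?F (translate (h \<otimes> g) \<xi>) \<eta> y
        + s * ?F (translate (h \<otimes> inv g) \<xi>) \<eta> (inv g \<otimes> y) + ?F (translate h \<xi>) \<eta> (inv g \<otimes> y)) \<partial>\<mu>)"
    unfolding inner_L2_def
  proof (rule Bochner_Integration.integral_cong[OF refl])
    fix y assume "y \<in> space \<mu>"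
    then have y: "y \<in> carrier G" by (simp add: space_eq)
    have "s * cnj s = 1" "cnj s = s" using s by auto
    then show "translate h (half_sum s g \<xi>) y * cnj (half_sum s g \<eta> y)
      = (1 / 4) * (?F (translate h \<xi>) \<eta> y + s * ?F (translate (h \<otimes> g) \<xi>) \<eta> y
        + s * ?F (translate (h \<otimes> inv g) \<xi>) \<eta> (inv g \<otimes> y) + ?F (translate h \<xi>) \<eta> (inv g \<otimes> y))"
      unfolding hg[OF y] hg'[OF y] using hg''[OF y]
      by (simp add: half_sum_def translate_def algebra_simps)
  qed
  also have "\<dots> = (1 / 4) * (inner_L2 (translate h \<xi>) \<eta> + s * inner_L2 (translate (h \<otimes> g) \<xi>) \<eta>
      + s * (\<integral>y. ?F (translate (h \<otimes> inv g) \<xi>) \<eta> (inv g \<otimes> y) \<partial>\<mu>)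
      + (\<integral>y. ?F (translate h \<xi>) \<eta> (inv g \<otimes> y) \<partial>\<mu>))"
    unfolding inner_L2_def using int by simp
  also have "\<dots> = (2 * inner_L2 (translate h \<xi>) \<eta> + s * inner_L2 (translate (h \<otimes> g) \<xi>) \<eta>
        + s * inner_L2 (translate (h \<otimes> inv g) \<xi>) \<eta>) / 4"
    using integral_translation[OF g borel_measurable_integrable[OF integrable_inner_L2(1)[OF L2s(3) \<eta>]]]
      integral_translation[OF g borel_measurable_integrable[OF integrable_inner_L2(1)[OF L2s(1) \<eta>]]]
    by (simp add: inner_L2_def field_simps)
  finally show ?thesis .
qed


lemma regular_coefficient_eq:
  assumes "g \<in> carrier G"
  shows "inner_L2 (translate g \<xi>) \<eta> = (\<integral>y. \<xi> (inv g \<otimes> y) * cnj (\<eta> y) \<partial>\<mu>)"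
  by (simp add: inner_L2_def translate_def)

text \<open>Replacing (\<xi>, \<eta>) by (s \<xi>, \<eta> / s) changes no coefficient, so the
  mean-of-squares bound may be optimised over \<open>s\<close>.\<close>

lemma le_L2_norm_mult_if_le_power2:
  assumes \<xi>: "\<xi> \<in> L2 \<mu>" and \<eta>: "\<eta> \<in> L2 \<mu>"
    and le: "\<And>\<xi>' \<eta>'. \<xi>' \<in> L2 \<mu> \<Longrightarrow> \<eta>' \<in> L2 \<mu> \<Longrightarrow>
      (\<And>g. inner_L2 (translate g \<xi>') \<eta>' = inner_L2 (translate g \<xi>) \<eta>) \<Longrightarrow>
      t \<le> ((L2_norm \<mu> \<xi>')\<^sup>2 + (L2_norm \<mu> \<eta>')\<^sup>2) / 2"
  shows "t \<le> L2_norm \<mu> \<xi> * L2_norm \<mu> \<eta>"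
proof (rule le_mult_if_le_scaled_sum[OF L2_norm_nonneg L2_norm_nonneg])
  fix s :: real assume "s > 0"
  define \<xi>' where "\<xi>' = (\<lambda>y. complex_of_real s * \<xi> y)"
  define \<eta>' where "\<eta>' = (\<lambda>y. complex_of_real (1 / s) * \<eta> y)"
  have "translate g \<xi>' y * cnj (\<eta>' y) = translate g \<xi> y * cnj (\<eta> y)" for g y
    using \<open>s > 0\<close> by (simp add: translate_def \<xi>'_def \<eta>'_def)
  then have "inner_L2 (translate g \<xi>') \<eta>' = inner_L2 (translate g \<xi>) \<eta>" for g
    by (simp add: inner_L2_def)
  then have "t \<le> ((L2_norm \<mu> \<xi>')\<^sup>2 + (L2_norm \<mu> \<eta>')\<^sup>2) / 2"
    by (intro le) (auto simp: \<xi>'_def \<eta>'_def intro!: L2_scale \<xi> \<eta> simp del: of_real_divide)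
  then show "t \<le> ((s * L2_norm \<mu> \<xi>)\<^sup>2 + (L2_norm \<mu> \<eta> / s)\<^sup>2) / 2"
    using \<open>s > 0\<close> unfolding \<xi>'_def \<eta>'_def L2_norm_scale by (simp add: norm_divide)
qed

lemma inner_L2_translate_le_power2:
  assumes "g \<in> carrier G" "\<xi> \<in> L2 \<mu>" "\<eta> \<in> L2 \<mu>"
  shows "cmod (inner_L2 (translate g \<xi>) \<eta>) \<le> ((L2_norm \<mu> \<xi>)\<^sup>2 + (L2_norm \<mu> \<eta>)\<^sup>2) / 2"
proof -
  have "(L2_norm \<mu> (translate g \<xi>))\<^sup>2 = (L2_norm \<mu> \<xi>)\<^sup>2"
    unfolding L2_norm_power2 translate_def using L2_measurable[OF assms(2)]
    by (intro integral_translation[OF assms(1)]) measurable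
  then show ?thesis
    using integrable_inner_L2(2)[OF L2_translate[OF assms(1,2)] assms(3)] by simp
qed

lemma inner_L2_translate_le:
  assumes "g \<in> carrier G" and \<xi>: "\<xi> \<in> L2 \<mu>" and \<eta>: "\<eta> \<in> L2 \<mu>"
  shows "cmod (inner_L2 (translate g \<xi>) \<eta>) \<le> L2_norm \<mu> \<xi> * L2_norm \<mu> \<eta>"
  using inner_L2_translate_le_power2[OF assms(1)]
  by (intro le_L2_norm_mult_if_le_power2[OF \<xi> \<eta>]) metis

end

section \<open>Arithmetic of the absolute value\<close>

context nonarch_local_field
begin

lemma absv_zero [simp]: "absv 0 = 0"
  by (simp add: absv_eq_0_iff)

lemma absv_one [simp]: "absv 1 = 1"
  using absv_mult[of 1 1] absv_eq_0_iff[of 1] by simp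

lemma absv_minus [simp]: "absv (- x) = absv x"
proof -
  have "absv (- 1) * absv (- 1) = 1" using absv_mult[of "- 1" "- 1"] by simp
  then have "absv (- 1) = 1"
    using absv_nonneg[of "- 1"] by (simp add: power2_eq_1_iff[of "absv (- 1)", unfolded power2_eq_square])
  then show ?thesis using absv_mult[of "- 1" x] by simp
qed

lemma absv_power: "absv (x ^ n) = absv x ^ n"
  by (induction n) (simp_all add: absv_mult)

lemma absv_diff_le: "absv (x - y) \<le> max (absv x) (absv y)"
  using absv_ultrametric[of x "- y"] by simp

text \<open>If the sum were smaller than \<open>x\<close>, then \<open>x\<close>, as the difference
  of the sum and \<open>y\<close>, would be too.\<close>

lemma absv_add_eq:
  assumes "absv y < absv x"
  shows "absv (x + y) = absv x"
  using absv_ultrametric[of x y] absv_diff_le[of "x + y" y] assms by (auto simp: max_def split: if_splits)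

lemma integers_of_closed:
  shows "0 \<in> integers_of absv" "1 \<in> integers_of absv"
    and "x \<in> integers_of absv \<Longrightarrow> - x \<in> integers_of absv"
    and "x \<in> integers_of absv \<Longrightarrow> y \<in> integers_of absv \<Longrightarrow> x + y \<in> integers_of absv"
    and "x \<in> integers_of absv \<Longrightarrow> y \<in> integers_of absv \<Longrightarrow> x - y \<in> integers_of absv"
    and "x \<in> integers_of absv \<Longrightarrow> y \<in> integers_of absv \<Longrightarrow> x * y \<in> integers_of absv"
  using absv_ultrametric[of x y] absv_diff_le[of x y] absv_nonneg[of x] absv_nonneg[of y]
  by (auto simp: integers_of_def absv_mult mult_le_one max_def split: if_splits)

text \<open>A nonzero element off the unit sphere is small itself or has a small inverse.\<close>

lemma exists_small: "\<exists>\<pi>. 0 < absv \<pi> \<and> absv \<pi> < 1"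
proof -
  obtain x where x: "x \<noteq> 0" "absv x \<noteq> 1" using absv_nontrivial by blast
  then have pos: "absv x > 0" using absv_nonneg[of x] absv_eq_0_iff[of x] by linarith
  have "absv x * absv (inverse x) = 1" using x(1) absv_mult[of x "inverse x"] by simp
  then have inv: "absv (inverse x) = 1 / absv x" using pos by (simp add: field_simps)
  show ?thesis
  proof (cases "absv x < 1")
    case True with pos show ?thesis by blast
  next
    case False
    then have "0 < absv (inverse x) \<and> absv (inverse x) < 1" using x(2) pos unfolding inv by simp
    then show ?thesis by blast
  qed
qed

end

section \<open>Variation of radial coefficients along the powers of \<pi>\<close>

locale haar_group_with_integers = haar_group G \<mu> + nonarch_local_field absv
  for G :: "('g::metric_space, 'm) monoid_scheme" (structure) and \<mu>
    and absv :: "'f::{field,metric_space} \<Rightarrow> real" +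
  fixes \<tau> :: "'f \<Rightarrow> 'g" and \<pi> :: 'f
  assumes \<tau>_closed: "a \<in> integers_of absv \<Longrightarrow> \<tau> a \<in> carrier G"
    and \<tau>_add: "a \<in> integers_of absv \<Longrightarrow> b \<in> integers_of absv \<Longrightarrow> \<tau> (a + b) = \<tau> a \<otimes> \<tau> b"
    and absv_\<pi>: "0 < absv \<pi>" "absv \<pi> < 1"
begin

lemma \<pi>_power_integer: "\<pi> ^ n \<in> integers_of absv"
  using absv_\<pi> by (simp add: integers_of_def absv_power power_le_one)

lemma \<tau>_minus:
  assumes "a \<in> integers_of absv"
  shows "\<tau> (- a) = inv (\<tau> a)"
proof -
  have "\<tau> 0 \<otimes> \<tau> 0 = \<tau> 0" using \<tau>_add[of 0 0] by (simp add: integers_of_closed)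
  then have "\<tau> 0 = \<one>" using \<tau>_closed[of 0] l_cancel_one by (simp add: integers_of_closed)
  then have "\<tau> (- a) \<otimes> \<tau> a = \<one>" using \<tau>_add[of "- a" a] assms by (simp add: integers_of_closed)
  then show ?thesis using inv_equality \<tau>_closed assms integers_of_closed(3) by metis
qed

text \<open>
  The value \<open>m k\<close> is the coefficient at the identity after averaging over the translations by
  \<open>\<tau> (\<pi> ^ j)\<close> for \<open>k \<le> j < n\<close>; the induction peels off the smallest translation first.
\<close>

lemma radial_coefficient:
  assumes "\<xi> \<in> L2 \<mu>" "\<eta> \<in> L2 \<mu>"
    and "\<And>a b. a \<in> integers_of absv \<Longrightarrow> b \<in> integers_of absv \<Longrightarrow> absv a = absv b \<Longrightarrow>
      absv a > absv \<pi> ^ n \<Longrightarrow> inner_L2 (translate (\<tau> a) \<xi>) \<eta> = inner_L2 (translate (\<tau> b) \<xi>) \<eta>"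
  shows "\<exists>m. m n = inner_L2 (translate (\<tau> 0) \<xi>) \<eta> \<and>
    (\<forall>k<n. inner_L2 (translate (\<tau> (\<pi> ^ k)) \<xi>) \<eta> = 2 * m k - m (Suc k)) \<and>
    (\<Sum>k<n. cmod (m (Suc k) - m k)) \<le> ((L2_norm \<mu> \<xi>)\<^sup>2 + (L2_norm \<mu> \<eta>)\<^sup>2) / 2"
  using assms
proof (induction n arbitrary: \<xi> \<eta>)
  case 0
  show ?case by (intro exI[of _ "\<lambda>_. inner_L2 (translate (\<tau> 0) \<xi>) \<eta>"]) simp
next
  case (Suc n)
  note \<xi> = Suc.prems(1) and \<eta> = Suc.prems(2) and radial = Suc.prems(3)
  let ?g = "\<tau> (\<pi> ^ n)"
  define \<xi>' where "\<xi>' = (\<lambda>s. half_sum s ?g \<xi>)"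
  define \<eta>' where "\<eta>' = (\<lambda>s. half_sum s ?g \<eta>)"
  define w where "w = (\<lambda>a. inner_L2 (translate (\<tau> a) \<xi>) \<eta>)"
  have g: "?g \<in> carrier G" by (intro \<tau>_closed \<pi>_power_integer)
  have L2': "\<xi>' s \<in> L2 \<mu>" "\<eta>' s \<in> L2 \<mu>" for s
    unfolding \<xi>'_def \<eta>'_def by (intro L2_half_sum g \<xi> \<eta>)+
  have w': "inner_L2 (translate (\<tau> a) (\<xi>' s)) (\<eta>' s)
      = (2 * w a + s * w (a + \<pi> ^ n) + s * w (a - \<pi> ^ n)) / 4"
    if "a \<in> integers_of absv" "s = 1 \<or> s = - 1" for a s
  proof -
    have "?g \<otimes> \<tau> a = \<tau> a \<otimes> ?g"
      using \<tau>_add[OF that(1) \<pi>_power_integer] \<tau>_add[OF \<pi>_power_integer that(1)] by (simp add: add.commute)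
    moreover have "\<tau> a \<otimes> inv ?g = \<tau> (a - \<pi> ^ n)"
      using \<tau>_add[OF that(1) integers_of_closed(3)[OF \<pi>_power_integer]] \<tau>_minus[OF \<pi>_power_integer] by simp
    ultimately show ?thesis
      using inner_L2_half_sum[OF g \<tau>_closed[OF that(1)] _ that(2) \<xi> \<eta>] \<tau>_add[OF that(1) \<pi>_power_integer]
      unfolding \<xi>'_def \<eta>'_def w_def by simp
  qed
  \<comment> \<open>The radiality hypothesis reaches strictly below \<open>absv \<pi> ^ n\<close>,
    so it covers arguments of exactly this absolute value as well.\<close>
  have pow_less: "absv \<pi> ^ Suc n < absv \<pi> ^ n" using absv_\<pi> by (simp add: mult_less_cancel_right)
  \<comment> \<open>Averaging is invisible at larger arguments: shifting \<open>a\<close> by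
    \<open>\<pi> ^ n\<close> in either direction keeps its absolute value, so the three values of
    \<open>w\<close> coincide. Hence the averaged pair satisfies the induction hypothesis.\<close>
  have w'_eq: "inner_L2 (translate (\<tau> a) (\<xi>' 1)) (\<eta>' 1) = w a"
    if "a \<in> integers_of absv" "absv a > absv \<pi> ^ n" for a
  proof -
    have "absv (a + \<pi> ^ n) = absv a" "absv (a - \<pi> ^ n) = absv a"
      using absv_add_eq[of "\<pi> ^ n" a] absv_add_eq[of "- (\<pi> ^ n)" a] that(2) by (simp_all add: absv_power)
    then have "w (a + \<pi> ^ n) = w a" "w (a - \<pi> ^ n) = w a"
      unfolding w_def using that pow_less
      by (auto intro!: radial integers_of_closed \<pi>_power_integer)
    then show ?thesis using w'[OF that(1), of 1] by simp
  qed
  have "\<exists>m. m n = inner_L2 (translate (\<tau> 0) (\<xi>' 1)) (\<eta>' 1) \<and>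
    (\<forall>k<n. inner_L2 (translate (\<tau> (\<pi> ^ k)) (\<xi>' 1)) (\<eta>' 1) = 2 * m k - m (Suc k)) \<and>
    (\<Sum>k<n. cmod (m (Suc k) - m k)) \<le> ((L2_norm \<mu> (\<xi>' 1))\<^sup>2 + (L2_norm \<mu> (\<eta>' 1))\<^sup>2) / 2"
  proof (rule Suc.IH[OF L2'])
    fix a b assume *: "a \<in> integers_of absv" "b \<in> integers_of absv" "absv a = absv b" "absv a > absv \<pi> ^ n"
    then have "w a = w b" unfolding w_def using pow_less by (intro radial) auto
    then show "inner_L2 (translate (\<tau> a) (\<xi>' 1)) (\<eta>' 1) = inner_L2 (translate (\<tau> b) (\<xi>' 1)) (\<eta>' 1)"
      using w'_eq * by simp
  qed
  then obtain m where m: "m n = inner_L2 (translate (\<tau> 0) (\<xi>' 1)) (\<eta>' 1)"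
    "\<And>k. k < n \<Longrightarrow> inner_L2 (translate (\<tau> (\<pi> ^ k)) (\<xi>' 1)) (\<eta>' 1) = 2 * m k - m (Suc k)"
    "(\<Sum>k<n. cmod (m (Suc k) - m k)) \<le> ((L2_norm \<mu> (\<xi>' 1))\<^sup>2 + (L2_norm \<mu> (\<eta>' 1))\<^sup>2) / 2"
    by blast
  have "w (- (\<pi> ^ n)) = w (\<pi> ^ n)"
    unfolding w_def using pow_less
    by (intro radial integers_of_closed \<pi>_power_integer) (auto simp: absv_power)
  \<comment> \<open>At the identity the two shifts contribute equal values. Only \<open>w 0\<close>
    and \<open>w (\<pi> ^ n)\<close> remain: their half sum for \<open>s = 1\<close>, their half
    difference for \<open>s = - 1\<close>.\<close>
  then have zero: "inner_L2 (translate (\<tau> 0) (\<xi>' s)) (\<eta>' s) = (w 0 + s * w (\<pi> ^ n)) / 2" if "s = 1 \<or> s = - 1" for s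
  proof -
    have "inner_L2 (translate (\<tau> 0) (\<xi>' s)) (\<eta>' s)
        = (2 * w 0 + s * w (0 + \<pi> ^ n) + s * w (0 - \<pi> ^ n)) / 4"
      by (rule w'[OF integers_of_closed(1) that])
    also have "\<dots> = (w 0 + s * w (\<pi> ^ n)) / 2"
      unfolding diff_0 add_0 \<open>w (- (\<pi> ^ n)) = w (\<pi> ^ n)\<close> by (simp add: field_simps)
    finally show ?thesis .
  qed
  \<comment> \<open>The new last entry is the coefficient at the identity before averaging. The
    entry before it, taken after averaging, is the mean of \<open>w 0\<close> and
    \<open>w (\<pi> ^ n)\<close>, which is the required relation for \<open>k = n\<close>.\<close>
  define m' where "m' = m(Suc n := w 0)"
  have m'_le: "m' k = m k" if "k \<le> n" for k using that by (simp add: m'_def)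
  have "w (\<pi> ^ k) = 2 * m' k - m' (Suc k)" if "k < Suc n" for k
  proof (cases "k = n")
    case True
    then show ?thesis using m(1) zero[of 1] by (simp add: m'_def field_simps)
  next
    case False
    then have "k < n" using that by simp
    moreover have "absv (\<pi> ^ k) > absv \<pi> ^ n" using absv_\<pi> \<open>k < n\<close> by (simp add: absv_power power_strict_decreasing)
    ultimately show ?thesis using m(2)[of k] w'_eq[OF \<pi>_power_integer, of k] by (simp add: m'_le)
  qed
  moreover have "(\<Sum>k<Suc n. cmod (m' (Suc k) - m' k)) \<le> ((L2_norm \<mu> \<xi>)\<^sup>2 + (L2_norm \<mu> \<eta>)\<^sup>2) / 2"
  proof -
    \<comment> \<open>The last increment is a coefficient of the \<open>s = - 1\<close> parts, while
      the earlier increments are bounded by the \<open>s = 1\<close> parts. The parallelogram law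
      adds the two bounds without loss.\<close>
    have "m' (Suc n) - m' n = w 0 - (w 0 + 1 * w (\<pi> ^ n)) / 2"
      unfolding zero[of 1, OF disjI1[OF refl], symmetric] using m(1) by (simp add: m'_def)
    also have "\<dots> = (w 0 + (- 1) * w (\<pi> ^ n)) / 2"
      by (simp add: field_simps)
    also have "\<dots> = inner_L2 (translate (\<tau> 0) (\<xi>' (- 1))) (\<eta>' (- 1))"
      by (rule zero[symmetric]) simp
    finally have "cmod (m' (Suc n) - m' n) \<le> ((L2_norm \<mu> (\<xi>' (- 1)))\<^sup>2 + (L2_norm \<mu> (\<eta>' (- 1)))\<^sup>2) / 2"
      using inner_L2_translate_le_power2[OF \<tau>_closed[OF integers_of_closed(1)] L2'] by simp
    moreover have "(\<Sum>k<n. cmod (m' (Suc k) - m' k)) = (\<Sum>k<n. cmod (m (Suc k) - m k))"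
      by (intro sum.cong) (auto simp: m'_le)
    ultimately show ?thesis
      using m(3) L2_norm_half_sum[OF g \<xi>] L2_norm_half_sum[OF g \<eta>]
      unfolding \<xi>'_def \<eta>'_def by simp
  qed
  ultimately show ?case
    by (intro exI[of _ m']) (auto simp: m'_def w_def)
qed

text \<open>A difference of consecutive values \<open>2 * m k - m (Suc k)\<close> involves two
  consecutive increments of \<open>m\<close>, with weights 2 and 1; hence the constant 3.\<close>

lemma radial_variation:
  assumes \<xi>: "\<xi> \<in> L2 \<mu>" and \<eta>: "\<eta> \<in> L2 \<mu>"
    and radial: "\<And>a b. a \<in> integers_of absv \<Longrightarrow> b \<in> integers_of absv \<Longrightarrow> absv a = absv b \<Longrightarrow>
      inner_L2 (translate (\<tau> a) \<xi>) \<eta> = inner_L2 (translate (\<tau> b) \<xi>) \<eta>"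
  shows "(\<Sum>k<n. cmod (inner_L2 (translate (\<tau> (\<pi> ^ Suc k)) \<xi>) \<eta>
      - inner_L2 (translate (\<tau> (\<pi> ^ k)) \<xi>) \<eta>)) \<le> 3 * (L2_norm \<mu> \<xi> * L2_norm \<mu> \<eta>)"
proof -
  define w where "w = (\<lambda>k. inner_L2 (translate (\<tau> (\<pi> ^ k)) \<xi>) \<eta>)"
  have "(\<Sum>k<n. cmod (w (Suc k) - w k)) / 3 \<le> L2_norm \<mu> \<xi> * L2_norm \<mu> \<eta>"
  proof (rule le_L2_norm_mult_if_le_power2[OF \<xi> \<eta>])
    fix \<xi>' \<eta>' assume L2': "\<xi>' \<in> L2 \<mu>" "\<eta>' \<in> L2 \<mu>"
      and eq: "\<And>g. inner_L2 (translate g \<xi>') \<eta>' = inner_L2 (translate g \<xi>) \<eta>"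
    \<comment> \<open>The differences reach up to \<open>w n\<close>, so the relation is needed for
      all \<open>k < Suc n\<close>.\<close>
    have "\<exists>m. m (Suc n) = inner_L2 (translate (\<tau> 0) \<xi>') \<eta>' \<and>
        (\<forall>k<Suc n. inner_L2 (translate (\<tau> (\<pi> ^ k)) \<xi>') \<eta>' = 2 * m k - m (Suc k)) \<and>
        (\<Sum>k<Suc n. cmod (m (Suc k) - m k)) \<le> ((L2_norm \<mu> \<xi>')\<^sup>2 + (L2_norm \<mu> \<eta>')\<^sup>2) / 2"
      unfolding eq by (rule radial_coefficient[OF L2', unfolded eq]) (rule radial)
    then obtain m where m: "\<And>k. k < Suc n \<Longrightarrow> w k = 2 * m k - m (Suc k)"
      "(\<Sum>k<Suc n. cmod (m (Suc k) - m k)) \<le> ((L2_norm \<mu> \<xi>')\<^sup>2 + (L2_norm \<mu> \<eta>')\<^sup>2) / 2"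
      unfolding eq w_def by blast
    have "(\<Sum>k<n. cmod (w (Suc k) - w k))
        \<le> (\<Sum>k<n. 2 * cmod (m (Suc k) - m k) + cmod (m (Suc (Suc k)) - m (Suc k)))"
    proof (rule sum_mono)
      fix k assume "k \<in> {..<n}"
      then have "w (Suc k) - w k = 2 * (m (Suc k) - m k) - (m (Suc (Suc k)) - m (Suc k))"
        using m(1)[of k] m(1)[of "Suc k"] by simp
      then show "cmod (w (Suc k) - w k) \<le> 2 * cmod (m (Suc k) - m k) + cmod (m (Suc (Suc k)) - m (Suc k))"
        using norm_triangle_ineq4[of "2 * (m (Suc k) - m k)" "m (Suc (Suc k)) - m (Suc k)"]
        by (simp only: norm_mult norm_numeral)
    qed
    also have "\<dots> = 2 * (\<Sum>k<n. cmod (m (Suc k) - m k)) + (\<Sum>k<n. cmod (m (Suc (Suc k)) - m (Suc k)))"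
      by (simp add: sum.distrib sum_distrib_left)
    also have "\<dots> \<le> 3 * (\<Sum>k<Suc n. cmod (m (Suc k) - m k))"
      using sum.lessThan_Suc_shift[of "\<lambda>k. cmod (m (Suc k) - m k)" n]
        sum.lessThan_Suc[of "\<lambda>k. cmod (m (Suc k) - m k)" n]
        norm_ge_zero[of "m (Suc n) - m n"] norm_ge_zero[of "m (Suc 0) - m 0"] by linarith
    finally show "(\<Sum>k<n. cmod (w (Suc k) - w k)) / 3 \<le> ((L2_norm \<mu> \<xi>')\<^sup>2 + (L2_norm \<mu> \<eta>')\<^sup>2) / 2"
      using m(2) by simp
  qed
  then show ?thesis by (simp add: w_def)
qed

end

section \<open>Haar measure on profinite groups\<close>

text \<open>A profinite group presented by open subgroups whose left cosets form a base of the
  topology, so that a left-invariant measure can be built by counting cosets.\<close>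

locale compact_group_with_subgroups = Group.group G
  for G :: "('g::metric_space, 'm) monoid_scheme" (structure) +
  fixes K :: "nat \<Rightarrow> 'g set"
  assumes compact_carrier: "compact (carrier G)"
    and subgroup_K: "subgroup (K n) G"
    and decseq_K: "decseq K"
    and openin_coset: "g \<in> carrier G \<Longrightarrow> openin (top_of_set (carrier G)) (g <# K n)"
    and coset_basis: "openin (top_of_set (carrier G)) U \<Longrightarrow> g \<in> U \<Longrightarrow> \<exists>n. g <# K n \<subseteq> U"
begin

lemma K_subset: "K n \<subseteq> carrier G"
  by (rule subgroup.subset[OF subgroup_K])

lemma K_antimono: "n \<le> m \<Longrightarrow> K m \<subseteq> K n"
  using decseq_K by (simp add: decseqD)

lemma coset_subset: "g \<in> carrier G \<Longrightarrow> g <# K n \<subseteq> carrier G"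
  by (rule l_coset_subset_G[OF K_subset])

lemma in_coset_self: "g \<in> carrier G \<Longrightarrow> g \<in> g <# K n"
  using subgroup.one_closed[OF subgroup_K[of n]] unfolding l_coset_def by force

lemma coset_eqI: "g \<in> carrier G \<Longrightarrow> h \<in> g <# K n \<Longrightarrow> h <# K n = g <# K n"
  by (rule l_repr_independence[OF _ _ subgroup_K, symmetric])

lemma coset_antimono: "n \<le> m \<Longrightarrow> g <# K m \<subseteq> g <# K n"
  using K_antimono unfolding l_coset_def by blast

section \<open>Left cosets and the sets saturated by them\<close>

definition cosets :: "nat \<Rightarrow> 'g set \<Rightarrow> 'g set set"
  where "cosets n A = (\<lambda>x. x <# K n) ` A"

definition saturated :: "nat \<Rightarrow> 'g set \<Rightarrow> bool"
  where "saturated n A \<longleftrightarrow> A \<subseteq> carrier G \<and> (\<forall>x\<in>A. x <# K n \<subseteq> A)"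

text \<open>The algebra on which the content is first defined; it is shown below to generate the
  Borel sets of the carrier.\<close>

definition clopens :: "'g set set"
  where "clopens = {A. \<exists>n. saturated n A}"

lemma saturated_subset: "saturated n A \<Longrightarrow> A \<subseteq> carrier G"
  by (simp add: saturated_def)

lemma saturated_mono: "saturated n A \<Longrightarrow> n \<le> m \<Longrightarrow> saturated m A"
  using coset_antimono unfolding saturated_def by blast

lemma saturated_coset: "g \<in> carrier G \<Longrightarrow> saturated n (g <# K n)"
  unfolding saturated_def using coset_subset coset_eqI by (metis order_refl)

lemma saturated_carrier: "saturated n (carrier G)"
  unfolding saturated_def using coset_subset by blast

lemma saturated_Un: "saturated n A \<Longrightarrow> saturated n B \<Longrightarrow> saturated n (A \<union> B)"
  unfolding saturated_def by blast

lemma saturated_Diff: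
  assumes "saturated n A"
  shows "saturated n (carrier G - A)"
  unfolding saturated_def
proof (intro conjI ballI subsetI)
  fix x y assume x: "x \<in> carrier G - A" and y: "y \<in> x <# K n"
  then have "y \<in> carrier G" using coset_subset by blast
  moreover have "x \<in> y <# K n" using coset_eqI[of x y n] x y in_coset_self[of x n] by blast
  ultimately show "y \<in> carrier G - A" using x assms unfolding saturated_def by blast
qed auto

text \<open>The cosets are an open cover. Since cosets with a common point coincide, a subcover must
  already contain all of them.\<close>

lemma cosets_carrier_finite: "finite (cosets n (carrier G))"
proof -
  have "\<exists>\<D>\<subseteq>cosets n (carrier G). finite \<D> \<and> carrier G \<subseteq> \<Union>\<D>"
    using compact_carrier unfolding compact_eq_openin_cover
  proof (elim allE[of _ "cosets n (carrier G)"] impE)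
    show "(\<forall>c\<in>cosets n (carrier G). openin (top_of_set (carrier G)) c) \<and> carrier G \<subseteq> \<Union> (cosets n (carrier G))"
      using openin_coset in_coset_self by (auto simp: cosets_def)
  qed auto
  then obtain \<D> where \<D>: "\<D> \<subseteq> cosets n (carrier G)" "finite \<D>" "carrier G \<subseteq> \<Union>\<D>" by blast
  have "cosets n (carrier G) \<subseteq> \<D>"
  proof
    fix C assume "C \<in> cosets n (carrier G)"
    then obtain x where x: "x \<in> carrier G" "C = x <# K n" by (auto simp: cosets_def)
    then obtain y where "y \<in> carrier G" "y <# K n \<in> \<D>" "x \<in> y <# K n"
      using \<D> by (force simp: cosets_def)
    then show "C \<in> \<D>" using coset_eqI x by metis
  qed
  then show ?thesis using \<D>(2) finite_subset by blast
qed

lemma cosets_finite: "A \<subseteq> carrier G \<Longrightarrow> finite (cosets n A)"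
  by (rule finite_subset[OF _ cosets_carrier_finite]) (auto simp: cosets_def)

lemma cosets_translate:
  assumes "g \<in> carrier G" "A \<subseteq> carrier G"
  shows "cosets n (g <# A) = (\<lambda>C. g <# C) ` cosets n A"
proof -
  have "g <# A = (\<lambda>x. g \<otimes> x) ` A" by (auto simp: l_coset_def)
  moreover have "(g \<otimes> x) <# K n = g <# (x <# K n)" if "x \<in> A" for x
    using lcos_m_assoc[OF K_subset assms(1)] assms(2) that by auto
  ultimately show ?thesis by (auto simp: cosets_def image_image)
qed

lemma inj_on_l_coset:
  assumes "g \<in> carrier G"
  shows "inj_on (\<lambda>C. g <# C) (Pow (carrier G))"
proof (rule inj_on_inverseI)
  fix C assume "C \<in> Pow (carrier G)"
  then show "inv g <# (g <# C) = C"
    using assms lcos_m_assoc[of C "inv g" g] lcos_mult_one by simp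
qed

lemma card_cosets_translate:
  assumes "g \<in> carrier G" "A \<subseteq> carrier G"
  shows "card (cosets n (g <# A)) = card (cosets n A)"
proof -
  have "cosets n A \<subseteq> Pow (carrier G)" using assms(2) coset_subset by (auto simp: cosets_def)
  then show ?thesis
    unfolding cosets_translate[OF assms] by (intro card_image inj_on_subset[OF inj_on_l_coset[OF assms(1)]])
qed

lemma card_cosets_Union:
  assumes "finite I" "\<And>i. i \<in> I \<Longrightarrow> saturated n (A i)" "disjoint_family_on A I"
  shows "card (cosets n (\<Union>i\<in>I. A i)) = (\<Sum>i\<in>I. card (cosets n (A i)))"
proof -
  have "cosets n (\<Union>i\<in>I. A i) = (\<Union>i\<in>I. cosets n (A i))" by (auto simp: cosets_def)
  also have "card \<dots> = (\<Sum>i\<in>I. card (cosets n (A i)))"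
  proof (rule card_UN_disjoint[OF assms(1)])
    show "\<forall>i\<in>I. finite (cosets n (A i))"
      using cosets_finite[OF saturated_subset[OF assms(2)]] by simp
    show "\<forall>i\<in>I. \<forall>j\<in>I. i \<noteq> j \<longrightarrow> cosets n (A i) \<inter> cosets n (A j) = {}"
    proof (intro ballI impI)
      fix i j assume ij: "i \<in> I" "j \<in> I" "i \<noteq> j"
      have False if C: "C \<in> cosets n (A i)" "C \<in> cosets n (A j)" for C
      proof -
        obtain x where x: "x \<in> A i" "C = x <# K n" using C(1) by (auto simp: cosets_def)
        obtain y where y: "y \<in> A j" "C = y <# K n" using C(2) by (auto simp: cosets_def)
        have "x \<in> C"
          unfolding x(2) using saturated_subset[OF assms(2)[OF ij(1)]] x(1) by (intro in_coset_self) auto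
        then have "x \<in> A j" using assms(2)[OF ij(2)] y unfolding saturated_def by auto
        then show False using disjoint_family_onD[OF assms(3) ij] x(1) by blast
      qed
      then show "cosets n (A i) \<inter> cosets n (A j) = {}" by blast
    qed
  qed
  finally show ?thesis .
qed

text \<open>Every coset of \<open>K n\<close> is a translate of \<open>K n\<close> and therefore
  splits into the same number of cosets of \<open>K m\<close>, the index of \<open>K m\<close> in
  \<open>K n\<close>.\<close>

lemma card_cosets_refine:
  assumes A: "saturated n A" and "n \<le> m"
  shows "card (cosets m A) = card (cosets n A) * card (cosets m (K n))"
proof -
  have "A = \<Union> (cosets n A)"
    using A in_coset_self unfolding saturated_def cosets_def by blast
  then have "card (cosets m A) = card (cosets m (\<Union>C\<in>cosets n A. C))" by simp
  also have "\<dots> = (\<Sum>C\<in>cosets n A. card (cosets m C))"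
  proof (rule card_cosets_Union)
    show "finite (cosets n A)" using A saturated_subset cosets_finite by blast
    show "saturated m C" if "C \<in> cosets n A" for C
      using that A saturated_subset saturated_coset saturated_mono[OF _ \<open>n \<le> m\<close>] unfolding cosets_def by blast
    show "disjoint_family_on (\<lambda>C. C) (cosets n A)"
      unfolding disjoint_family_on_def
    proof (intro ballI impI)
      fix C D assume CD: "C \<in> cosets n A" "D \<in> cosets n A" "C \<noteq> D"
      then obtain x y where xy: "x \<in> carrier G" "C = x <# K n" "y \<in> carrier G" "D = y <# K n"
        using saturated_subset[OF A] unfolding cosets_def by blast
      have "C = D" if "z \<in> C" "z \<in> D" for z
        using coset_eqI[OF xy(1), of z n] coset_eqI[OF xy(3), of z n] that xy(2,4) by simp
      then show "C \<inter> D = {}" using CD(3) by blast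
    qed
  qed
  also have "\<dots> = (\<Sum>C\<in>cosets n A. card (cosets m (K n)))"
  proof (rule sum.cong[OF refl])
    fix C assume "C \<in> cosets n A"
    then obtain x where "x \<in> carrier G" "C = x <# K n" using A saturated_subset unfolding cosets_def by blast
    then show "card (cosets m C) = card (cosets m (K n))" using card_cosets_translate K_subset by simp
  qed
  finally show ?thesis by simp
qed

lemma card_cosets_pos: "A \<subseteq> carrier G \<Longrightarrow> A \<noteq> {} \<Longrightarrow> card (cosets n A) > 0"
  using cosets_finite by (simp add: card_gt_0_iff cosets_def)

section \<open>The content given by the proportion of cosets\<close>

definition ratio :: "nat \<Rightarrow> 'g set \<Rightarrow> real"
  where "ratio n A = card (cosets n A) / card (cosets n (carrier G))"

text \<open>The value does not depend on the chosen level: refining multiplies numerator and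
  denominator of \<open>ratio\<close> by the same index.\<close>

definition content :: "'g set \<Rightarrow> ennreal"
  where "content A = ennreal (ratio (SOME n. saturated n A) A)"

lemma ratio_refine:
  assumes "saturated n A" "n \<le> m"
  shows "ratio m A = ratio n A"
proof -
  have "K n \<noteq> {}" using subgroup.one_closed[OF subgroup_K[of n]] by blast
  then show ?thesis
    using card_cosets_pos[OF K_subset, of n m] unfolding ratio_def
    by (simp add: card_cosets_refine[OF assms] card_cosets_refine[OF saturated_carrier \<open>n \<le> m\<close>])
qed

lemma content_eq:
  assumes "saturated n A"
  shows "content A = ennreal (ratio n A)"
proof -
  define k where "k = (SOME n. saturated n A)"
  have "saturated k A" unfolding k_def using assms by (rule someI)
  then have "ratio k A = ratio n A"
    using ratio_refine[of k A "max k n"] ratio_refine[OF assms, of "max k n"] by simp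
  then show ?thesis by (simp add: content_def k_def)
qed

lemma clopens_Pow: "clopens \<subseteq> Pow (carrier G)"
  using saturated_subset by (auto simp: clopens_def)

lemma clopens_common:
  assumes "A \<in> clopens" "B \<in> clopens"
  obtains n where "saturated n A" "saturated n B"
proof -
  obtain k m where "saturated k A" "saturated m B" using assms unfolding clopens_def by blast
  then have "saturated (max k m) A" "saturated (max k m) B" using saturated_mono by auto
  then show ?thesis using that by blast
qed

lemma algebra_clopens: "Sigma_Algebra.algebra (carrier G) clopens"
  unfolding algebra_iff_Un
proof (intro conjI ballI)
  show "clopens \<subseteq> Pow (carrier G)" by (rule clopens_Pow)
  show "{} \<in> clopens" by (auto simp: clopens_def saturated_def)
  fix A assume A: "A \<in> clopens"
  then show "carrier G - A \<in> clopens" using saturated_Diff by (auto simp: clopens_def)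
  fix B assume "B \<in> clopens"
  with A obtain n where "saturated n A" "saturated n B" by (rule clopens_common)
  then show "A \<union> B \<in> clopens" using saturated_Un by (auto simp: clopens_def)
qed

lemma openin_clopen:
  assumes "A \<in> clopens"
  shows "openin (top_of_set (carrier G)) A"
proof -
  obtain n where "saturated n A" using assms by (auto simp: clopens_def)
  then have "A = (\<Union>x\<in>A. x <# K n)" using in_coset_self unfolding saturated_def by blast
  moreover have "openin (top_of_set (carrier G)) (\<Union>x\<in>A. x <# K n)"
    using openin_coset saturated_subset[OF \<open>saturated n A\<close>] by (intro openin_Union) auto
  ultimately show ?thesis by simp
qed

lemma compact_clopen:
  assumes "A \<in> clopens"
  shows "compact A"
proof -
  have "carrier G - A \<in> clopens" using assms Sigma_Algebra.algebra.compl_sets[OF algebra_clopens] by blast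
  moreover have "A \<subseteq> carrier G" using assms saturated_subset by (auto simp: clopens_def)
  ultimately have "closedin (top_of_set (carrier G)) A"
    using openin_clopen by (simp add: closedin_def)
  then show ?thesis using compact_carrier closedin_compact by blast
qed

lemma translate_saturated:
  assumes "g \<in> carrier G" "saturated n A"
  shows "saturated n (g <# A)"
proof -
  have sub: "A \<subseteq> carrier G" using assms(2) saturated_subset by blast
  have "(g \<otimes> x) <# K n \<subseteq> g <# A" if "x \<in> A" for x
  proof -
    have "(g \<otimes> x) <# K n = g <# (x <# K n)" using lcos_m_assoc[OF K_subset assms(1)] sub that by auto
    moreover have "x <# K n \<subseteq> A" using assms(2) that by (simp add: saturated_def)
    moreover have "g <# C \<subseteq> g <# A" if "C \<subseteq> A" for C using that by (auto simp: l_coset_def)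
    ultimately show ?thesis by simp
  qed
  then show ?thesis
    unfolding saturated_def using l_coset_subset_G[OF sub assms(1)] by (auto simp: l_coset_def)
qed

section \<open>Extension of the content to a Haar measure\<close>

lemma exists_content_measure:
  "\<exists>\<nu>. (\<forall>A\<in>clopens. \<nu> A = content A) \<and> measure_space (carrier G) (sigma_sets (carrier G) clopens) \<nu>"
proof (rule ring_of_sets.caratheodory_empty_continuous)
  show "ring_of_sets (carrier G) clopens"
    using algebra_clopens by (simp add: Sigma_Algebra.algebra.axioms(1))
  show "positive clopens content"
    using content_eq[of 0 "{}"] by (simp add: positive_def saturated_def ratio_def cosets_def)
  show "additive clopens content"
    unfolding additive_def
  proof (intro ballI impI)
    fix A B assume "A \<in> clopens" "B \<in> clopens" "A \<inter> B = {}"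
    then obtain n where n: "saturated n A" "saturated n B" using clopens_common by blast
    have "card (cosets n (\<Union>i\<in>{True, False}. if i then A else B))
        = (\<Sum>i\<in>{True, False}. card (cosets n (if i then A else B)))"
      using n \<open>A \<inter> B = {}\<close> by (intro card_cosets_Union) (auto simp: disjoint_family_on_def)
    then have "ratio n (A \<union> B) = ratio n A + ratio n B" by (simp add: ratio_def add_divide_distrib Un_commute)
    then show "content (A \<union> B) = content A + content B"
      using content_eq[OF n(1)] content_eq[OF n(2)] content_eq[OF saturated_Un[OF n]]
      by (simp add: ennreal_plus[symmetric] ratio_def del: ennreal_plus)
  qed
  show "content A \<noteq> \<infinity>" if "A \<in> clopens" for A by (simp add: content_def)
  show "(\<lambda>i. content (A i)) \<longlonglongrightarrow> 0" if A: "range A \<subseteq> clopens" "decseq A" "(\<Inter>i. A i) = {}" for A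
  proof -
    \<comment> \<open>The members of the algebra are compact, so a decreasing sequence of them with
      empty intersection has an empty member. Continuity at the empty set is thus automatic.\<close>
    have "\<exists>i. A i = {}"
    proof (rule ccontr)
      assume ne: "\<nexists>i. A i = {}"
      have "A 0 \<inter> \<Inter>(range A) \<noteq> {}"
      proof (rule compact_imp_fip)
        show "compact (A 0)" "\<And>T. T \<in> range A \<Longrightarrow> closed T"
          using A(1) compact_clopen compact_imp_closed by auto
        fix F assume F: "finite F" "F \<subseteq> range A"
        then obtain I where I: "finite I" "F = A ` I" using finite_subset_image[OF F] by blast
        \<comment> \<open>Index 0 is included because \<open>A 0\<close> itself takes part in the
          intersection.\<close>
        define m where "m = Max (insert 0 I)"
        have "A m \<subseteq> A i" if "i \<in> insert 0 I" for i
        proof (rule decseqD[OF A(2)])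
          show "i \<le> m" unfolding m_def using I(1) that by (intro Max_ge) auto
        qed
        then have "A m \<subseteq> A 0 \<inter> \<Inter>F" unfolding I(2) by auto
        then show "A 0 \<inter> \<Inter>F \<noteq> {}" using ne by blast
      qed
      then show False using A(3) by auto
    qed
    then obtain i where i: "A i = {}" by blast
    have "A j = {}" if "j \<ge> i" for j using decseqD[OF A(2) that] i by simp
    moreover have "content {} = 0"
      using content_eq[of 0 "{}"] by (simp add: saturated_def ratio_def cosets_def)
    ultimately have "eventually (\<lambda>j. content (A j) = 0) sequentially"
      unfolding eventually_sequentially by (intro exI[of _ i]) simp
    then show ?thesis by (rule tendsto_eventually)
  qed
qed

text \<open>At each level only finitely many cosets lie inside a given open set, and the cosets of
  all levels form a base, so every relatively open set is a countable union of cosets.\<close>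

lemma sets_borel_carrier: "sets (restrict_space borel (carrier G)) = sigma_sets (carrier G) clopens"
proof -
  have "carrier G \<in> sigma_sets UNIV {S. open S}"
    using borel_closed[OF compact_imp_closed[OF compact_carrier]] by (simp add: sets_borel)
  then have "sets (restrict_space borel (carrier G)) = sigma_sets (carrier G) ((\<inter>) (carrier G) ` {S. open S})"
    unfolding sets_restrict_space sets_borel by (rule sigma_sets_Int) simp
  also have "\<dots> = sigma_sets (carrier G) clopens"
  proof (rule sigma_sets_eqI)
    fix U assume "U \<in> (\<inter>) (carrier G) ` {S. open S}"
    then have U: "openin (top_of_set (carrier G)) U" by (auto simp: openin_open)
    interpret sigma_algebra "carrier G" "sigma_sets (carrier G) clopens"
      by (rule sigma_algebra_sigma_sets[OF clopens_Pow])
    have "U = (\<Union>n. \<Union>{C \<in> cosets n (carrier G). C \<subseteq> U})"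
    proof
      have "U \<subseteq> carrier G" using openin_imp_subset[OF U] .
      then show "U \<subseteq> (\<Union>n. \<Union>{C \<in> cosets n (carrier G). C \<subseteq> U})"
      proof (intro subsetI)
        fix g assume "g \<in> U"
        then obtain n where "g <# K n \<subseteq> U" using coset_basis[OF U] by blast
        moreover have "g \<in> carrier G" using \<open>g \<in> U\<close> \<open>U \<subseteq> carrier G\<close> by blast
        ultimately show "g \<in> (\<Union>n. \<Union>{C \<in> cosets n (carrier G). C \<subseteq> U})"
          using in_coset_self[of g n] by (auto simp: cosets_def)
      qed
    qed blast
    also have "\<dots> \<in> sigma_sets (carrier G) clopens"
    proof -
      have "\<Union>{C \<in> cosets n (carrier G). C \<subseteq> U} \<in> sigma_sets (carrier G) clopens" for n
      proof (rule countable_Union)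
        show "countable {C \<in> cosets n (carrier G). C \<subseteq> U}"
          using cosets_carrier_finite[of n] by (intro countable_finite) auto
        show "{C \<in> cosets n (carrier G). C \<subseteq> U} \<subseteq> sigma_sets (carrier G) clopens"
          using saturated_coset by (auto simp: cosets_def clopens_def)
      qed
      then show ?thesis by (intro countable_UN) auto
    qed
    finally show "U \<in> sigma_sets (carrier G) clopens" .
  next
    fix A assume "A \<in> clopens"
    then show "A \<in> sigma_sets (carrier G) ((\<inter>) (carrier G) ` {S. open S})"
      using openin_clopen[of A] by (auto simp: openin_open)
  qed
  finally show ?thesis .
qed

text \<open>It suffices to test preimages of the generating algebra, and translates of saturated
  sets are saturated.\<close>

lemma measurable_l_translation:
  assumes g: "g \<in> carrier G" and "sets M = sets (restrict_space borel (carrier G))"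
  shows "(\<lambda>y. g \<otimes> y) \<in> measurable M M"
proof (rule measurable_sigma_sets)
  show "sets M = sigma_sets (carrier G) clopens" using assms(2) sets_borel_carrier by simp
  have space: "space M = carrier G" using sets_eq_imp_space_eq[OF assms(2)] by (simp add: space_restrict_space)
  show "clopens \<subseteq> Pow (carrier G)" by (rule clopens_Pow)
  show "(\<lambda>y. g \<otimes> y) \<in> space M \<rightarrow> carrier G" using g space by auto
  fix A assume "A \<in> clopens"
  then obtain n where n: "saturated n A" by (auto simp: clopens_def)
  then have "(\<lambda>y. g \<otimes> y) -` A \<inter> space M = inv g <# A"
    unfolding space by (intro vimage_translation g saturated_subset)
  then show "(\<lambda>y. g \<otimes> y) -` A \<inter> space M \<in> sets M"
    using translate_saturated[OF inv_closed[OF g] n] unfolding assms(2) sets_borel_carrier clopens_def by auto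
qed

text \<open>Left translation permutes the cosets of each level, so the measure and its translate
  agree on \<open>clopens\<close>. This generator is stable under intersections, so they agree on
  all Borel sets.\<close>

lemma exists_haar_measure: "\<exists>\<mu>. is_haar_measure G \<mu>"
proof -
  obtain \<nu> where \<nu>: "\<And>A. A \<in> clopens \<Longrightarrow> \<nu> A = content A"
    and space: "measure_space (carrier G) (sigma_sets (carrier G) clopens) \<nu>"
    using exists_content_measure by blast
  define \<mu> where "\<mu> = measure_of (carrier G) clopens \<nu>"
  have sets: "sets \<mu> = sigma_sets (carrier G) clopens" and space_\<mu>: "space \<mu> = carrier G"
    unfolding \<mu>_def using clopens_Pow by (simp_all add: sets_measure_of space_measure_of)
  have emeasure_clopen: "emeasure \<mu> A = content A" if "A \<in> clopens" for A
    using space that \<nu> unfolding measure_space_def \<mu>_def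
    by (subst emeasure_measure_of[OF refl clopens_Pow]) (auto simp: sets_measure_of[OF clopens_Pow])
  have carrier: "carrier G \<in> clopens" using saturated_carrier by (auto simp: clopens_def)
  have one: "emeasure \<mu> (carrier G) = 1"
    using card_cosets_pos[of "carrier G" 0] emeasure_clopen[OF carrier] content_eq[OF saturated_carrier[of 0]]
    by (auto simp: ratio_def)
  have "emeasure \<mu> (g <# A) = emeasure \<mu> A" if g: "g \<in> carrier G" and A: "A \<in> sets \<mu>" for g A
  proof -
    have meas: "(\<lambda>y. inv g \<otimes> y) \<in> measurable \<mu> \<mu>"
      using g sets sets_borel_carrier by (intro measurable_l_translation) auto
    have vimage: "(\<lambda>y. inv g \<otimes> y) -` A \<inter> space \<mu> = g <# A" if "A \<subseteq> carrier G" for A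
      unfolding space_\<mu> using vimage_translation[OF inv_closed[OF g] that] g by simp
    have "distr \<mu> \<mu> (\<lambda>y. inv g \<otimes> y) = \<mu>"
    proof (rule measure_eqI_generator_eq)
      show "Int_stable clopens"
        unfolding Int_stable_def
      proof (intro ballI)
        fix A B assume "A \<in> clopens" "B \<in> clopens"
        then obtain n where "saturated n A" "saturated n B" by (rule clopens_common)
        then have "saturated n (A \<inter> B)" by (auto simp: saturated_def)
        then show "A \<inter> B \<in> clopens" by (auto simp: clopens_def)
      qed
      show "clopens \<subseteq> Pow (carrier G)" by (rule clopens_Pow)
      fix B assume B: "B \<in> clopens"
      then obtain n where n: "saturated n B" by (auto simp: clopens_def)
      have "emeasure (distr \<mu> \<mu> (\<lambda>y. inv g \<otimes> y)) B = emeasure \<mu> (g <# B)"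
        using B meas sets vimage[OF saturated_subset[OF n]] by (simp add: emeasure_distr)
      also have "\<dots> = content (g <# B)"
        using translate_saturated[OF g n] by (intro emeasure_clopen) (auto simp: clopens_def)
      also have "\<dots> = content B"
        using content_eq[OF translate_saturated[OF g n]] content_eq[OF n]
          card_cosets_translate[OF g saturated_subset[OF n]] by (simp add: ratio_def)
      finally show "emeasure (distr \<mu> \<mu> (\<lambda>y. inv g \<otimes> y)) B = emeasure \<mu> B"
        using emeasure_clopen[OF B] by simp
    next
      show "range (\<lambda>i::nat. carrier G) \<subseteq> clopens" using carrier by auto
      show "emeasure (distr \<mu> \<mu> (\<lambda>y. inv g \<otimes> y)) (carrier G) \<noteq> \<infinity>"
        using meas one carrier sets g space_\<mu> vimage[of "carrier G"]
        by (simp add: emeasure_distr) (metis emeasure_space ennreal_one_less_top leD)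
    qed (use sets in auto)
    then have "emeasure \<mu> A = emeasure \<mu> ((\<lambda>y. inv g \<otimes> y) -` A \<inter> space \<mu>)"
      using emeasure_distr[OF meas A] by simp
    moreover have "A \<subseteq> carrier G" using A sets.sets_into_space space_\<mu> by blast
    ultimately show ?thesis using vimage by simp
  qed
  then have "is_haar_measure G \<mu>"
    unfolding is_haar_measure_def using one sets space_\<mu> sets_borel_carrier by simp
  then show ?thesis by blast
qed

text \<open>\<open>haar\<close> is a choice among Haar measures, so existence makes it one.\<close>

lemma is_haar_measure_haar: "is_haar_measure G (haar G)"
  unfolding haar_def using exists_haar_measure by (rule someI_ex)

end

sublocale compact_group_with_subgroups \<subseteq> haar_group G "haar G"
proof unfold_locales
  show haar: "is_haar_measure G (haar G)" by (rule is_haar_measure_haar)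
  show "(\<lambda>y. g \<otimes> y) \<in> measurable (haar G) (haar G)" if "g \<in> carrier G" for g
    using haar that by (intro measurable_l_translation) (auto simp: is_haar_measure_def)
qed

section \<open>Indicators of the open subgroups as coefficients\<close>

context compact_group_with_subgroups
begin

lemma coset_in_sets: "g \<in> carrier G \<Longrightarrow> g <# K n \<in> sets (haar G)"
  using haar_measure saturated_coset unfolding is_haar_measure_def sets_borel_carrier clopens_def by auto

lemma K_in_sets: "K n \<in> sets (haar G)"
  using coset_in_sets[OF one_closed, of n] lcos_mult_one[OF K_subset] by simp

text \<open>Finitely many translates, all of the same measure, cover a space of measure 1.\<close>

lemma measure_K_pos: "measure (haar G) (K n) > 0"
proof (rule ccontr)
  assume "\<not> measure (haar G) (K n) > 0"
  then have "emeasure (haar G) (K n) = 0"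
    using measure_nonneg[of "haar G" "K n"] by (simp add: emeasure_eq_measure)
  then have "emeasure (haar G) (g <# K n) = 0" if "g \<in> carrier G" for g
    using emeasure_l_coset[OF that K_in_sets] by simp
  then have "C \<in> null_sets (haar G)" if "C \<in> cosets n (carrier G)" for C
    using that coset_in_sets by (auto simp: cosets_def null_sets_def)
  then have "\<Union> (cosets n (carrier G)) \<in> null_sets (haar G)"
    using null_sets.finite_Union[of "cosets n (carrier G)"] cosets_carrier_finite by auto
  moreover have "carrier G = \<Union> (cosets n (carrier G))"
    using in_coset_self coset_subset unfolding cosets_def by blast
  ultimately have "emeasure (haar G) (space (haar G)) = 0"
    unfolding space_eq by (metis null_setsD1)
  then show False using emeasure_space_1 by simp
qed

lemma indicator_in_L2: "A \<in> sets (haar G) \<Longrightarrow> (\<lambda>y. c * of_bool (y \<in> A)) \<in> L2 (haar G)"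
proof -
  assume [measurable]: "A \<in> sets (haar G)"
  have "integrable (haar G) (\<lambda>y. (cmod (c * of_bool (y \<in> A)))\<^sup>2)"
    by (rule integrable_const_bound[where B = "(cmod c)\<^sup>2"]) auto
  then show ?thesis by (simp add: L2_def)
qed

text \<open>The intersection of \<open>K n\<close> with its translate by \<open>x\<close> is
  \<open>K n\<close> if \<open>x\<close> lies in \<open>K n\<close> and empty otherwise. Pairing the
  indicator, divided by the measure of \<open>K n\<close>, with the indicator itself therefore
  returns the indicator.\<close>

lemma indicator_in_fourier_functions: "(\<lambda>x. of_bool (x \<in> K n)) \<in> fourier_functions G"
proof -
  define \<xi> where "\<xi> = (\<lambda>y. complex_of_real (1 / measure (haar G) (K n)) * of_bool (y \<in> K n))"
  define \<eta> where "\<eta> = (\<lambda>y. 1 * of_bool (y \<in> K n) :: complex)"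
  have "regular_coefficient G \<xi> \<eta> x = of_bool (x \<in> K n)" for x
  proof (cases "x \<in> carrier G")
    case True
    have iff: "inv x \<otimes> y \<in> K n \<longleftrightarrow> x \<in> K n" if "y \<in> K n" for y
    proof
      assume "x \<in> K n"
      then show "inv x \<otimes> y \<in> K n"
        using that subgroup.m_closed[OF subgroup_K] subgroup.m_inv_closed[OF subgroup_K] by blast
    next
      assume *: "inv x \<otimes> y \<in> K n"
      have y: "y \<in> carrier G" using that K_subset by blast
      have "inv (inv x \<otimes> y) \<in> K n" using * by (rule subgroup.m_inv_closed[OF subgroup_K])
      then have "y \<otimes> inv (inv x \<otimes> y) \<in> K n" using that by (intro subgroup.m_closed[OF subgroup_K])
      moreover have "y \<otimes> inv (inv x \<otimes> y) = x"
        using True y by (simp add: inv_mult_group m_assoc[symmetric])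
      ultimately show "x \<in> K n" by simp
    qed
    have "regular_coefficient G \<xi> \<eta> x
        = (\<integral>y. complex_of_real (of_bool (x \<in> K n) / measure (haar G) (K n) * indicator (K n) y) \<partial>haar G)"
      unfolding regular_coefficient_def if_P[OF True]
    proof (rule Bochner_Integration.integral_cong[OF refl])
      fix y
      show "\<xi> (inv x \<otimes> y) * cnj (\<eta> y)
          = complex_of_real (of_bool (x \<in> K n) / measure (haar G) (K n) * indicator (K n) y)"
        by (cases "y \<in> K n") (simp_all add: \<xi>_def \<eta>_def iff)
    qed
    also have "\<dots> = of_bool (x \<in> K n)"
      using measure_K_pos[of n] K_in_sets[of n] sets.sets_into_space[OF K_in_sets]
      unfolding integral_of_real by (simp add: Int_absorb2)
    finally show ?thesis .
  next
    case False
    then show ?thesis using K_subset by (auto simp: regular_coefficient_def)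
  qed
  then have "(\<lambda>x. of_bool (x \<in> K n)) = regular_coefficient G \<xi> \<eta>" by auto
  moreover have "\<xi> \<in> L2 (haar G)" "\<eta> \<in> L2 (haar G)"
    unfolding \<xi>_def \<eta>_def by (intro indicator_in_L2 K_in_sets)+
  ultimately show ?thesis unfolding fourier_functions_def by blast
qed

end

text \<open>The norm is an infimum over all representations of \<open>u\<close> as a coefficient, so
  an estimate valid for each of them passes to it. Membership in \<open>fourier_functions\<close>
  makes the set nonempty, without which \<open>Inf\<close> carries no information.\<close>

lemma fourier_norm_bound:
  assumes "u \<in> fourier_functions G" "C > 0"
    and "\<And>\<xi> \<eta>. \<xi> \<in> L2 (haar G) \<Longrightarrow> \<eta> \<in> L2 (haar G) \<Longrightarrow> u = regular_coefficient G \<xi> \<eta> \<Longrightarrow>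
      t \<le> C * (L2_norm (haar G) \<xi> * L2_norm (haar G) \<eta>)"
  shows "t \<le> C * fourier_norm G u"
proof -
  have "t / C \<le> fourier_norm G u"
    unfolding fourier_norm_def
  proof (rule cInf_greatest)
    show "{L2_norm (haar G) \<xi> * L2_norm (haar G) \<eta> |\<xi> \<eta>.
        \<xi> \<in> L2 (haar G) \<and> \<eta> \<in> L2 (haar G) \<and> u = regular_coefficient G \<xi> \<eta>} \<noteq> {}"
      using assms(1) unfolding fourier_functions_def by blast
    fix s assume "s \<in> {L2_norm (haar G) \<xi> * L2_norm (haar G) \<eta> |\<xi> \<eta>.
        \<xi> \<in> L2 (haar G) \<and> \<eta> \<in> L2 (haar G) \<and> u = regular_coefficient G \<xi> \<eta>}"
    then show "t / C \<le> s" using assms(2,3) by (auto simp: field_simps)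
  qed
  then show ?thesis using assms(2) by (simp add: field_simps)
qed

section \<open>Compactness of the ring of integers\<close>

context nonarch_local_field
begin

lemma absv_sum_le:
  assumes "\<And>i. i \<in> S \<Longrightarrow> absv (f i) \<le> c" "c \<ge> 0"
  shows "absv (sum f S) \<le> c"
  using assms(1)
proof (induction S rule: infinite_finite_induct)
  case (insert i S)
  then show ?case using absv_ultrametric[of "f i" "sum f S"] by (force simp: max_def split: if_splits)
qed (use assms(2) in auto)

lemma absv_small_imp_zero:
  assumes "\<And>e. e > 0 \<Longrightarrow> absv x \<le> e"
  shows "x = 0"
  using assms absv_nonneg[of x] absv_eq_0_iff field_le_epsilon[of "absv x" 0] by fastforce

lemma closed_integers: "closed (integers_of absv)"
  unfolding closed_def open_dist
proof (intro ballI)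
  fix x assume x: "x \<in> - integers_of absv"
  have "y \<in> - integers_of absv" if "dist y x < 1" for y
    using x that absv_ultrametric[of "x - y" y] absv_minus[of "x - y"]
    by (auto simp: dist_eq integers_of_def max_def split: if_splits)
  then show "\<exists>e>0. \<forall>y. dist y x < e \<longrightarrow> y \<in> - integers_of absv" by (intro exI[of _ 1]) auto
qed

text \<open>A power of some small \<pi> scales the integers into a compact neighbourhood of 0.
  Undoing the scaling exhibits them as a closed part of a compact set.\<close>

lemma compact_integers: "compact (integers_of absv)"
proof -
  obtain U V where UV: "open U" "compact V" "(0 :: 'f) \<in> U" "U \<subseteq> V"
    by (rule locallyE[OF locally_compact, of UNIV 0]) auto
  obtain e where e: "e > 0" "ball 0 e \<subseteq> V" by (rule openE[OF UV(1,3)]) (use UV(4) in auto)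
  obtain \<pi> where \<pi>: "0 < absv \<pi>" "absv \<pi> < 1" using exists_small by blast
  then have "\<pi> \<noteq> 0" by auto
  obtain n where n: "absv \<pi> ^ n < e" using real_arch_pow_inv[OF e(1) \<pi>(2)] by blast
  define c where "c = inverse (\<pi> ^ n)"
  have "integers_of absv \<subseteq> (\<lambda>x. c * x) ` V"
  proof
    fix x assume "x \<in> integers_of absv"
    then have "absv (\<pi> ^ n * x) \<le> absv \<pi> ^ n"
      using \<pi> by (simp add: integers_of_def absv_mult absv_power mult_left_le)
    then have "\<pi> ^ n * x \<in> V"
      using n e(2) by (auto simp: subset_iff dist_eq)
    moreover have "x = c * (\<pi> ^ n * x)" using \<open>\<pi> \<noteq> 0\<close> by (simp add: c_def)
    ultimately show "x \<in> (\<lambda>x. c * x) ` V" by blast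
  qed
  moreover have "compact ((\<lambda>x. c * x) ` V)"
  proof (rule compact_continuous_image[OF _ UV(2)])
    \<comment> \<open>Field operations and metric are linked only by \<open>dist_eq\<close>, which
      makes multiplication by \<open>c\<close> Lipschitz with constant \<open>absv c\<close>. Adding
      1 keeps the denominator positive.\<close>
    have "continuous_on UNIV (\<lambda>x. c * x)"
      unfolding continuous_on_iff
    proof (intro ballI allI impI)
      fix x :: 'f and d :: real assume "d > 0"
      have "absv c \<ge> 0" by (rule absv_nonneg)
      have "dist (c * y) (c * x) < d" if "dist y x < d / (absv c + 1)" for y
      proof -
        have "dist (c * y) (c * x) = absv c * dist y x"
          by (simp add: dist_eq absv_mult[symmetric] right_diff_distrib)
        also have "\<dots> \<le> (absv c + 1) * dist y x" by (intro mult_right_mono) auto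
        also have "\<dots> < d" using that \<open>absv c \<ge> 0\<close> by (simp add: field_simps)
        finally show ?thesis .
      qed
      then show "\<exists>d'>0. \<forall>y\<in>UNIV. dist y x < d' \<longrightarrow> dist (c * y) (c * x) < d"
        using \<open>d > 0\<close> \<open>absv c \<ge> 0\<close> by (intro exI[of _ "d / (absv c + 1)"]) auto
    qed
    then show "continuous_on V (\<lambda>x. c * x)" using continuous_on_subset by blast
  qed
  ultimately show ?thesis by (metis closed_Int_compact closed_integers inf.absorb_iff1)
qed

end

text \<open>The set is a continuous image of a product of compact sets in the function space, to
  which Tychonoff's theorem applies.\<close>

lemma compact_vec:
  fixes S :: "'a::topological_space set"
  assumes "compact S"
  shows "compact {x :: 'a^'n. \<forall>i. x $ i \<in> S}"
proof -
  have "compactin (product_topology (\<lambda>i::'n. euclidean) UNIV) (PiE UNIV (\<lambda>i. S))"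
    unfolding compactin_PiE using assms by auto
  then have "compact (PiE (UNIV :: 'n set) (\<lambda>i. S))"
    by (simp add: euclidean_product_topology)
  moreover have "continuous_on (PiE (UNIV :: 'n set) (\<lambda>i. S)) (\<lambda>f. \<chi> i. f i)"
    by (intro continuous_on_vec_lambda continuous_on_subset[OF continuous_on_product_coordinates] subset_UNIV)
  ultimately have "compact ((\<lambda>f. \<chi> i. f i) ` PiE (UNIV :: 'n set) (\<lambda>i. S))"
    by (rule compact_continuous_image[rotated])
  also have "(\<lambda>f. \<chi> i. f i) ` PiE (UNIV :: 'n set) (\<lambda>i. S) = {x. \<forall>i. x $ i \<in> S}"
  proof (intro equalityI subsetI)
    fix x :: "'a^'n" assume "x \<in> {x. \<forall>i. x $ i \<in> S}"
    then show "x \<in> (\<lambda>f. \<chi> i. f i) ` PiE UNIV (\<lambda>i. S)"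
      by (intro image_eqI[of _ _ "\<lambda>i. x $ i"]) auto
  qed auto
  finally show ?thesis .
qed

section \<open>The affine group over the integers\<close>

context nonarch_local_field
begin

section \<open>Coordinatewise ultrametric closeness\<close>

definition vec_close :: "real \<Rightarrow> 'f^'n \<Rightarrow> 'f^'n \<Rightarrow> bool"
  where "vec_close e x y \<longleftrightarrow> (\<forall>i. absv (x $ i - y $ i) \<le> e)"

definition mat_close :: "real \<Rightarrow> 'f^'n^'m \<Rightarrow> 'f^'n^'m \<Rightarrow> bool"
  where "mat_close e A B \<longleftrightarrow> (\<forall>i. vec_close e (A $ i) (B $ i))"

text \<open>For \<open>e \<ge> 0\<close> this is an equivalence relation compatible with the group
  multiplication. The balls of \<open>dist\<close> need not have this property, as that metric is
  built from sums of squares; \<open>close_if_dist_le\<close> and \<open>dist_le_if_close\<close>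
  compare the two.\<close>

definition close :: "real \<Rightarrow> ('f^'n) \<times> ('f^'n^'n) \<Rightarrow> ('f^'n) \<times> ('f^'n^'n) \<Rightarrow> bool"
  where "close e p q \<longleftrightarrow> vec_close e (fst p) (fst q) \<and> mat_close e (snd p) (snd q)"

abbreviation integral_vecs :: "('f^'n) set"
  where "integral_vecs \<equiv> {x. \<forall>i. x $ i \<in> integers_of absv}"

abbreviation integral_mats :: "('f^'n^'n) set"
  where "integral_mats \<equiv> {A. \<forall>i j. A $ i $ j \<in> integers_of absv}"

lemma absv_diff_trans:
  assumes "absv (x - y) \<le> e" "absv (y - z) \<le> e"
  shows "absv (x - z) \<le> e"
  using absv_ultrametric[of "x - y" "y - z"] assms by (simp add: max_def split: if_splits)

lemma absv_diff_commute: "absv (x - y) = absv (y - x)"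
  using absv_minus[of "x - y"] by simp

lemma close_refl: "e \<ge> 0 \<Longrightarrow> close e p p"
  by (simp add: close_def mat_close_def vec_close_def)

lemma close_sym: "close e p q \<Longrightarrow> close e q p"
  by (simp add: close_def mat_close_def vec_close_def absv_diff_commute)

lemma close_trans: "close e p q \<Longrightarrow> close e q r \<Longrightarrow> close e p r"
  unfolding close_def mat_close_def vec_close_def using absv_diff_trans by metis

lemma close_mono: "close e p q \<Longrightarrow> e \<le> e' \<Longrightarrow> close e' p q"
  unfolding close_def mat_close_def vec_close_def by (meson order_trans)

lemma absv_le_mult:
  assumes "absv x \<le> e" "y \<in> integers_of absv"
  shows "absv (x * y) \<le> e" "absv (y * x) \<le> e"
proof -
  have "absv x * absv y \<le> e * 1"
    using assms absv_nonneg[of x] absv_nonneg[of y] by (intro mult_mono) (auto simp: integers_of_def)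
  then show "absv (x * y) \<le> e" "absv (y * x) \<le> e" by (simp_all add: absv_mult mult.commute)
qed

text \<open>No factor depending on the dimension appears, because the ultrametric inequality bounds
  a sum by its largest term.\<close>

lemma mat_close_mult_left:
  fixes B B' :: "'f^'n^'n"
  assumes "e \<ge> 0" "A \<in> integral_mats" "mat_close e B B'"
  shows "mat_close e (A ** B) (A ** B')"
  unfolding mat_close_def vec_close_def
proof (intro allI)
  fix i j
  have "(A ** B) $ i $ j - (A ** B') $ i $ j = (\<Sum>k\<in>UNIV. A $ i $ k * (B $ k $ j - B' $ k $ j))"
    by (simp add: matrix_matrix_mult_def sum_subtractf right_diff_distrib)
  then show "absv ((A ** B) $ i $ j - (A ** B') $ i $ j) \<le> e"
    using assms by (auto simp: mat_close_def vec_close_def intro!: absv_sum_le absv_le_mult(2))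
qed

lemma mat_close_mult_right:
  fixes B B' :: "'f^'n^'n"
  assumes "e \<ge> 0" "A \<in> integral_mats" "mat_close e B B'"
  shows "mat_close e (B ** A) (B' ** A)"
  unfolding mat_close_def vec_close_def
proof (intro allI)
  fix i j
  have "(B ** A) $ i $ j - (B' ** A) $ i $ j = (\<Sum>k\<in>UNIV. (B $ i $ k - B' $ i $ k) * A $ k $ j)"
    by (simp add: matrix_matrix_mult_def sum_subtractf left_diff_distrib)
  then show "absv ((B ** A) $ i $ j - (B' ** A) $ i $ j) \<le> e"
    using assms by (auto simp: mat_close_def vec_close_def intro!: absv_sum_le absv_le_mult(1))
qed

lemma vec_close_mult_left:
  fixes A :: "'f^'n^'n"
  assumes "e \<ge> 0" "A \<in> integral_mats" "vec_close e x y"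
  shows "vec_close e (z + A *v x) (z + A *v y)"
  unfolding vec_close_def
proof
  fix i
  have "(z + A *v x) $ i - (z + A *v y) $ i = (\<Sum>k\<in>UNIV. A $ i $ k * (x $ k - y $ k))"
    by (simp add: matrix_vector_mult_def sum_subtractf right_diff_distrib)
  then show "absv ((z + A *v x) $ i - (z + A *v y) $ i) \<le> e"
    using assms by (auto simp: vec_close_def intro!: absv_sum_le absv_le_mult(2))
qed

lemma vec_close_mult_right:
  fixes B B' :: "'f^'n^'n"
  assumes "e \<ge> 0" "x \<in> integral_vecs" "mat_close e B B'" "vec_close e y z"
  shows "vec_close e (y + B *v x) (z + B' *v x)"
  unfolding vec_close_def
proof
  fix i
  have eq: "(y + B *v x) $ i - (z + B' *v x) $ i
      = (y $ i - z $ i) + (\<Sum>k\<in>UNIV. (B $ i $ k - B' $ i $ k) * x $ k)"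
    by (simp add: matrix_vector_mult_def sum_subtractf left_diff_distrib)
  have "absv (\<Sum>k\<in>UNIV. (B $ i $ k - B' $ i $ k) * x $ k) \<le> e"
    using assms by (auto simp: mat_close_def vec_close_def intro!: absv_sum_le absv_le_mult(1))
  then show "absv ((y + B *v x) $ i - (z + B' *v x) $ i) \<le> e"
    using assms(4) unfolding eq vec_close_def by (intro order_trans[OF absv_ultrametric]) simp
qed

lemma integral_mats_mult: "A \<in> integral_mats \<Longrightarrow> B \<in> integral_mats \<Longrightarrow> A ** B \<in> integral_mats"
  by (auto simp: matrix_matrix_mult_def integers_of_def intro!: absv_sum_le)
    (use integers_of_closed(6) in \<open>auto simp: integers_of_def\<close>)

lemma integral_vecs_mult: "A \<in> integral_mats \<Longrightarrow> x \<in> integral_vecs \<Longrightarrow> A *v x \<in> integral_vecs"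
  by (auto simp: matrix_vector_mult_def integers_of_def intro!: absv_sum_le)
    (use integers_of_closed(6) in \<open>auto simp: integers_of_def\<close>)

lemma mat_integral: "c \<in> integers_of absv \<Longrightarrow> mat c \<in> integral_mats"
  by (auto simp: mat_def integers_of_closed)

section \<open>The general linear group and the affine group over the integers\<close>

lemma monoid_integral_matrices: "Group.monoid (integral_matrices absv :: ('f^'n^'n) monoid)"
proof (rule monoidI)
  fix A B :: "'f^'n^'n"
  assume "A \<in> carrier (integral_matrices absv)" "B \<in> carrier (integral_matrices absv)"
  then show "A \<otimes>\<^bsub>integral_matrices absv\<^esub> B \<in> carrier (integral_matrices absv)"
    using integral_mats_mult[of A B] by (simp add: integral_matrices_def)
next
  show "\<one>\<^bsub>integral_matrices absv\<^esub> \<in> carrier (integral_matrices absv :: ('f^'n^'n) monoid)"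
    using mat_integral[of 1] integers_of_closed(2) by (simp add: integral_matrices_def)
qed (simp_all add: integral_matrices_def matrix_mul_assoc)

definition GL :: "('f^'n^'n) set"
  where "GL = {A \<in> integral_mats. \<exists>B\<in>integral_mats. A ** B = mat 1 \<and> B ** A = mat 1}"

lemma carrier_GL_integers: "carrier (GL_integers absv) = GL"
  by (auto simp: GL_integers_def units_of_carrier Units_def integral_matrices_def GL_def)

lemma mult_GL_integers: "A \<otimes>\<^bsub>GL_integers absv\<^esub> B = A ** B"
  by (simp add: GL_integers_def units_of_mult integral_matrices_def)

lemma one_GL_integers: "\<one>\<^bsub>GL_integers absv\<^esub> = mat 1"
  by (simp add: GL_integers_def units_of_one integral_matrices_def)

lemma group_GL_integers: "Group.group (GL_integers absv :: ('f^'n^'n) monoid)"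
  unfolding GL_integers_def by (rule monoid.units_group[OF monoid_integral_matrices])

lemma GL_integral: "A \<in> GL \<Longrightarrow> A \<in> integral_mats"
  by (simp add: GL_def)

lemma GL_mult: "A \<in> GL \<Longrightarrow> B \<in> GL \<Longrightarrow> A ** B \<in> GL"
  using Group.monoid.m_closed[OF group.is_monoid[OF group_GL_integers], of A B]
  by (simp add: carrier_GL_integers mult_GL_integers)

abbreviation AG :: "(('f^'n) \<times> ('f^'n^'n)) monoid"
  where "AG \<equiv> affine_integers absv"

lemma carrier_AG: "carrier AG = integral_vecs \<times> GL"
  by (simp add: affine_integers_def semidirect_product_def carrier_GL_integers integral_vectors_def)

lemma mult_AG: "p \<otimes>\<^bsub>AG\<^esub> q = (fst p + snd p *v fst q, snd p ** snd q)"
  by (simp add: affine_integers_def semidirect_product_def mult_GL_integers integral_vectors_def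
      split: prod.split)

lemma one_AG: "\<one>\<^bsub>AG\<^esub> = (0, mat 1)"
  by (simp add: affine_integers_def semidirect_product_def one_GL_integers integral_vectors_def)

lemma group_AG: "Group.group (AG :: (('f^'n) \<times> ('f^'n^'n)) monoid)"
proof (rule groupI)
  fix p q :: "('f^'n) \<times> ('f^'n^'n)" assume "p \<in> carrier AG" "q \<in> carrier AG"
  then show "p \<otimes>\<^bsub>AG\<^esub> q \<in> carrier AG"
    using integral_vecs_mult[OF GL_integral, of "snd p" "fst q"] GL_mult[of "snd p" "snd q"] integers_of_closed(4)
    by (auto simp: carrier_AG mult_AG)
next
  show "\<one>\<^bsub>AG\<^esub> \<in> carrier (AG :: (('f^'n) \<times> ('f^'n^'n)) monoid)"
    using group.is_monoid[OF group_GL_integers, THEN Group.monoid.one_closed]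
    by (simp add: carrier_AG one_AG carrier_GL_integers one_GL_integers integers_of_closed)
next
  fix p :: "('f^'n) \<times> ('f^'n^'n)" assume p: "p \<in> carrier AG"
  then obtain B where B: "B \<in> integral_mats" "snd p ** B = mat 1" "B ** snd p = mat 1"
    by (auto simp: carrier_AG GL_def)
  then have "B \<in> GL" using p by (auto simp: GL_def carrier_AG intro!: exI[of _ "snd p"])
  moreover have "- (B *v fst p) \<in> integral_vecs"
    using integral_vecs_mult[OF B(1), of "fst p"] p integers_of_closed(3) by (auto simp: carrier_AG)
  ultimately have "(- (B *v fst p), B) \<in> carrier AG" by (simp add: carrier_AG)
  moreover have "(- (B *v fst p), B) \<otimes>\<^bsub>AG\<^esub> p = \<one>\<^bsub>AG\<^esub>"
    using B by (simp add: mult_AG one_AG)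
  ultimately show "\<exists>q\<in>carrier AG. q \<otimes>\<^bsub>AG\<^esub> p = \<one>\<^bsub>AG\<^esub>" by blast
qed (auto simp: mult_AG one_AG matrix_mul_assoc matrix_vector_right_distrib matrix_vector_mul_assoc add.assoc)

section \<open>Congruence subgroups and the topology of the affine group\<close>

lemma close_mult_left:
  assumes "e \<ge> 0" "p \<in> carrier AG" "close e q r"
  shows "close e (p \<otimes>\<^bsub>AG\<^esub> q) (p \<otimes>\<^bsub>AG\<^esub> r)"
  using assms vec_close_mult_left[OF assms(1) GL_integral] mat_close_mult_left[OF assms(1) GL_integral]
  unfolding close_def mult_AG carrier_AG by auto

lemma close_mult_right:
  assumes "e \<ge> 0" "p \<in> carrier AG" "close e q r"
  shows "close e (q \<otimes>\<^bsub>AG\<^esub> p) (r \<otimes>\<^bsub>AG\<^esub> p)"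
  using assms vec_close_mult_right[OF assms(1), of "fst p"] mat_close_mult_right[OF assms(1) GL_integral, of "snd p"]
  unfolding close_def mult_AG carrier_AG by auto

lemma close_if_dist_le:
  assumes "dist p q \<le> e"
  shows "close e p q"
proof -
  have "dist (fst p) (fst q) \<le> e" "dist (snd p) (snd q) \<le> e"
    using assms dist_fst_le[of p q] dist_snd_le[of p q] by linarith+
  then show ?thesis
    unfolding close_def mat_close_def vec_close_def dist_eq[symmetric]
    by (meson dist_vec_nth_le order_trans)
qed

lemma dist_vec_le_card:
  fixes x y :: "('a::metric_space)^'n"
  assumes "\<And>i. dist (x $ i) (y $ i) \<le> e"
  shows "dist x y \<le> real CARD('n) * e"
proof -
  have "dist x y \<le> (\<Sum>i\<in>UNIV. dist (x $ i) (y $ i))"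
    unfolding dist_vec_def by (rule L2_set_le_sum) simp
  also have "\<dots> \<le> (\<Sum>i\<in>(UNIV :: 'n set). e)" by (intro sum_mono assms)
  finally show ?thesis by simp
qed

lemma dist_le_if_close:
  fixes p q :: "('f^'n) \<times> ('f^'n^'n)"
  assumes "close e p q"
  shows "dist p q \<le> (real CARD('n) + real CARD('n) * real CARD('n)) * e"
proof -
  have "dist (fst p) (fst q) \<le> real CARD('n) * e"
    using assms unfolding close_def vec_close_def dist_eq[symmetric] by (intro dist_vec_le_card) auto
  moreover have "dist (snd p) (snd q) \<le> real CARD('n) * (real CARD('n) * e)"
    using assms unfolding close_def mat_close_def vec_close_def dist_eq[symmetric]
    by (intro dist_vec_le_card) auto
  moreover have "dist p q \<le> dist (fst p) (fst q) + dist (snd p) (snd q)"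
    unfolding dist_prod_def by (rule sqrt_sum_squares_le_sum) auto
  ultimately show ?thesis by (simp add: algebra_simps)
qed

text \<open>Pairs of a matrix and its inverse are cut out of a compact set by equations that survive
  limits; \<open>GL\<close> is the projection of this set of pairs.\<close>

lemma compact_GL: "compact (GL :: ('f^'n^'n) set)"
proof -
  have mats: "compact (integral_mats :: ('f^'n^'n) set)"
    using compact_vec[OF compact_vec[OF compact_integers]] by simp
  define P where "P = {(A, B). A \<in> integral_mats \<and> B \<in> integral_mats \<and> A ** B = mat 1 \<and> B ** A = (mat 1 :: 'f^'n^'n)}"
  have "closed P"
  proof -
    have "p \<in> P" if p: "p \<in> closure P" for p
    proof -
      obtain A B where AB: "p = (A, B)" by (cases p)
      have "P \<subseteq> integral_mats \<times> integral_mats" by (auto simp: P_def)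
      then have "closure P \<subseteq> integral_mats \<times> integral_mats"
        using mats by (intro closure_minimal closed_Times compact_imp_closed)
      then have A: "A \<in> integral_mats" and B: "B \<in> integral_mats" using p unfolding AB by blast+
      \<comment> \<open>The equations hold for a nearby pair in \<open>P\<close>; its factors are
        exchanged one at a time for those of the limit.\<close>
      have *: "mat_close e (A ** B) (mat 1) \<and> mat_close e (B ** A) (mat 1)" if e: "e > 0" for e
      proof -
        obtain A' B' where AB': "(A', B') \<in> P" "dist (A', B') (A, B) < e"
          using p e unfolding AB closure_approachable by (metis surj_pair)
        have A': "A' \<in> integral_mats" and B': "B' \<in> integral_mats" and eq: "A' ** B' = mat 1" "B' ** A' = mat 1"
          using AB'(1) by (auto simp: P_def)
        have mc: "mat_close e C D" if "dist C D \<le> e" for C D :: "'f^'n^'n"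
          using that unfolding mat_close_def vec_close_def dist_eq[symmetric] by (meson dist_vec_nth_le order_trans)
        have "mat_close e A A'" "mat_close e B B'"
          using AB'(2) dist_fst_le[of "(A', B')" "(A, B)"] dist_snd_le[of "(A', B')" "(A, B)"]
          by (auto intro!: mc simp: dist_commute)
        then have "mat_close e (A ** B) (A ** B')" "mat_close e (A ** B') (A' ** B')"
          "mat_close e (B ** A) (B ** A')" "mat_close e (B ** A') (B' ** A')"
          using e A B A' B' by (auto intro: mat_close_mult_left mat_close_mult_right)
        moreover have "mat_close e C E" if "mat_close e C D" "mat_close e D E" for C D E :: "'f^'n^'n"
          using that absv_diff_trans unfolding mat_close_def vec_close_def by metis
        ultimately show ?thesis unfolding eq by metis
      qed
      have "C = D" if "\<And>e. e > 0 \<Longrightarrow> mat_close e C D" for C D :: "'f^'n^'n"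
        using absv_small_imp_zero[of "C $ i $ j - D $ i $ j" for i j] that
        by (simp add: mat_close_def vec_close_def vec_eq_iff)
      then have "A ** B = mat 1" "B ** A = mat 1" using * by blast+
      then show ?thesis using A B by (simp add: P_def AB)
    qed
    then show ?thesis using closure_subset_eq by blast
  qed
  then have "compact (P \<inter> (integral_mats \<times> integral_mats))"
    by (rule closed_Int_compact[OF _ compact_Times[OF mats mats]])
  moreover have "P \<inter> (integral_mats \<times> integral_mats) = P" by (auto simp: P_def)
  ultimately have "compact P" by simp
  then have "compact (fst ` P)" by (intro compact_continuous_image continuous_on_fst continuous_on_id)
  also have "fst ` P = GL" by (auto simp: P_def GL_def image_iff; blast)
  finally show ?thesis .
qed

lemma compact_carrier_AG: "compact (carrier (AG :: (('f^'n) \<times> ('f^'n^'n)) monoid))"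
  unfolding carrier_AG by (intro compact_Times compact_vec compact_integers compact_GL)

text \<open>For \<open>e \<ge> 0\<close>, the kernel of reduction modulo the ideal of integers of
  absolute value at most \<open>e\<close>.\<close>

definition congruence_subgroup :: "real \<Rightarrow> (('f^'n) \<times> ('f^'n^'n)) set"
  where "congruence_subgroup e = {p \<in> carrier AG. close e p \<one>\<^bsub>AG\<^esub>}"

lemma subgroup_congruence:
  assumes "e \<ge> 0"
  shows "subgroup (congruence_subgroup e) (AG :: (('f^'n) \<times> ('f^'n^'n)) monoid)"
proof -
  interpret Group.group "AG :: (('f^'n) \<times> ('f^'n^'n)) monoid" by (rule group_AG)
  show ?thesis
  proof (rule subgroupI)
    show "congruence_subgroup e \<subseteq> carrier AG" by (auto simp: congruence_subgroup_def)
    have "\<one>\<^bsub>AG :: (('f^'n) \<times> ('f^'n^'n)) monoid\<^esub> \<in> congruence_subgroup e"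
      using close_refl[OF assms] one_closed by (simp add: congruence_subgroup_def)
    then show "(congruence_subgroup e :: (('f^'n) \<times> ('f^'n^'n)) set) \<noteq> {}" by blast
  next
    fix p :: "('f^'n) \<times> ('f^'n^'n)" assume "p \<in> congruence_subgroup e"
    then show "inv\<^bsub>AG\<^esub> p \<in> congruence_subgroup e"
      using close_mult_left[OF assms, of "inv\<^bsub>AG\<^esub> p" p "\<one>\<^bsub>AG\<^esub>"] close_sym by (simp add: congruence_subgroup_def)
  next
    fix p q :: "('f^'n) \<times> ('f^'n^'n)" assume "p \<in> congruence_subgroup e" "q \<in> congruence_subgroup e"
    then show "p \<otimes>\<^bsub>AG\<^esub> q \<in> congruence_subgroup e"
      using close_mult_left[OF assms, of p q "\<one>\<^bsub>AG\<^esub>"] close_trans[of e "p \<otimes>\<^bsub>AG\<^esub> q" p]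
      by (simp add: congruence_subgroup_def)
  qed
qed

text \<open>Multiplication by \<open>p\<close> and by its inverse preserve closeness, so cosets are
  the balls of the ultrametric. This is the link between cosets and topology.\<close>

lemma l_coset_congruence:
  fixes p :: "('f^'n) \<times> ('f^'n^'n)"
  assumes "e \<ge> 0" "p \<in> carrier AG"
  shows "p <#\<^bsub>AG\<^esub> congruence_subgroup e = {q \<in> carrier AG. close e q p}"
proof -
  interpret Group.group "AG :: (('f^'n) \<times> ('f^'n^'n)) monoid" by (rule group_AG)
  show ?thesis
  proof (intro equalityI subsetI)
    fix q assume "q \<in> p <#\<^bsub>AG\<^esub> congruence_subgroup e"
    then show "q \<in> {q \<in> carrier AG. close e q p}"
      using assms close_mult_left[OF assms, of _ "\<one>\<^bsub>AG\<^esub>"] by (auto simp: l_coset_def congruence_subgroup_def)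
  next
    fix q assume q: "q \<in> {q \<in> carrier AG. close e q p}"
    then have "inv\<^bsub>AG\<^esub> p \<otimes>\<^bsub>AG\<^esub> q \<in> congruence_subgroup e"
      using assms close_mult_left[OF assms(1), of "inv\<^bsub>AG\<^esub> p" q p] by (simp add: congruence_subgroup_def)
    moreover have "q = p \<otimes>\<^bsub>AG\<^esub> (inv\<^bsub>AG\<^esub> p \<otimes>\<^bsub>AG\<^esub> q)"
      using q assms by (simp add: m_assoc[symmetric])
    ultimately show "q \<in> p <#\<^bsub>AG\<^esub> congruence_subgroup e" by (auto simp: l_coset_def)
  qed
qed

text \<open>Multiplication on either side preserves closeness, so these subgroups are normal; their
  indicators are therefore central functions.\<close>

lemma conjugate_in_congruence_iff:
  fixes g p :: "('f^'n) \<times> ('f^'n^'n)"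
  assumes "e \<ge> 0" "g \<in> carrier AG" "p \<in> carrier AG"
  shows "g \<otimes>\<^bsub>AG\<^esub> p \<otimes>\<^bsub>AG\<^esub> inv\<^bsub>AG\<^esub> g \<in> congruence_subgroup e \<longleftrightarrow> p \<in> congruence_subgroup e"
proof -
  interpret Group.group "AG :: (('f^'n) \<times> ('f^'n^'n)) monoid" by (rule group_AG)
  have conj: "h \<otimes>\<^bsub>AG\<^esub> q \<otimes>\<^bsub>AG\<^esub> inv\<^bsub>AG\<^esub> h \<in> congruence_subgroup e"
    if "h \<in> carrier AG" "q \<in> congruence_subgroup e" for h q :: "('f^'n) \<times> ('f^'n^'n)"
  proof -
    have "close e (h \<otimes>\<^bsub>AG\<^esub> q \<otimes>\<^bsub>AG\<^esub> inv\<^bsub>AG\<^esub> h) (h \<otimes>\<^bsub>AG\<^esub> \<one>\<^bsub>AG\<^esub> \<otimes>\<^bsub>AG\<^esub> inv\<^bsub>AG\<^esub> h)"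
      using that by (intro close_mult_right close_mult_left assms(1)) (auto simp: congruence_subgroup_def)
    then show ?thesis using that by (simp add: congruence_subgroup_def)
  qed
  show ?thesis
  proof
    assume "g \<otimes>\<^bsub>AG\<^esub> p \<otimes>\<^bsub>AG\<^esub> inv\<^bsub>AG\<^esub> g \<in> congruence_subgroup e"
    then have "inv\<^bsub>AG\<^esub> g \<otimes>\<^bsub>AG\<^esub> (g \<otimes>\<^bsub>AG\<^esub> p \<otimes>\<^bsub>AG\<^esub> inv\<^bsub>AG\<^esub> g) \<otimes>\<^bsub>AG\<^esub> inv\<^bsub>AG\<^esub> (inv\<^bsub>AG\<^esub> g) \<in> congruence_subgroup e"
      by (rule conj[OF inv_closed[OF assms(2)]])
    also have "inv\<^bsub>AG\<^esub> g \<otimes>\<^bsub>AG\<^esub> (g \<otimes>\<^bsub>AG\<^esub> p \<otimes>\<^bsub>AG\<^esub> inv\<^bsub>AG\<^esub> g) \<otimes>\<^bsub>AG\<^esub> inv\<^bsub>AG\<^esub> (inv\<^bsub>AG\<^esub> g) = p"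
      using assms by (simp add: m_assoc inv_solve_left')
    finally show "p \<in> congruence_subgroup e" .
  qed (use conj assms in auto)
qed

lemma compact_group_AG:
  assumes "0 < absv \<pi>" "absv \<pi> < 1"
  shows "compact_group_with_subgroups (AG :: (('f^'n) \<times> ('f^'n^'n)) monoid) (\<lambda>n. congruence_subgroup (absv \<pi> ^ n))"
proof (intro compact_group_with_subgroups.intro compact_group_with_subgroups_axioms.intro group_AG compact_carrier_AG)
  have pos: "absv \<pi> ^ n \<ge> 0" for n using assms by simp
  show "subgroup (congruence_subgroup (absv \<pi> ^ n)) (AG :: (('f^'n) \<times> ('f^'n^'n)) monoid)" for n
    by (rule subgroup_congruence[OF pos])
  show "decseq (\<lambda>n. congruence_subgroup (absv \<pi> ^ n) :: (('f^'n) \<times> ('f^'n^'n)) set)"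
    unfolding decseq_def using assms by (auto simp: congruence_subgroup_def intro: close_mono power_decreasing)
  fix g :: "('f^'n) \<times> ('f^'n^'n)"
  show "openin (top_of_set (carrier AG)) (g <#\<^bsub>AG\<^esub> congruence_subgroup (absv \<pi> ^ n))"
    if g: "g \<in> carrier AG" for n
    unfolding l_coset_congruence[OF pos g] openin_contains_ball
  proof (intro conjI ballI exI)
    \<comment> \<open>By transitivity of closeness, the metric ball of the same radius about any
      point of the coset stays inside it.\<close>
    fix p assume p: "p \<in> {q \<in> carrier AG. close (absv \<pi> ^ n) q g}"
    show "0 < absv \<pi> ^ n" using assms by simp
    show "ball p (absv \<pi> ^ n) \<inter> carrier AG \<subseteq> {q \<in> carrier AG. close (absv \<pi> ^ n) q g}"
      using p close_trans[OF close_if_dist_le, of _ p "absv \<pi> ^ n" g] by (auto simp: dist_commute)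
  qed auto
  fix U assume U: "openin (top_of_set (carrier AG)) U" "g \<in> U"
  then obtain e where e: "e > 0" "ball g e \<inter> carrier AG \<subseteq> U" unfolding openin_contains_ball by blast
  \<comment> \<open>The comparison constant of \<open>dist_le_if_close\<close>, which counts the
    entries of the vector and of the matrix.\<close>
  define C where "C = real CARD('n) + real CARD('n) * real CARD('n)"
  have "C > 0" by (simp add: C_def add_pos_pos)
  obtain n where n: "absv \<pi> ^ n < e / C" using real_arch_pow_inv[OF divide_pos_pos[OF e(1) \<open>C > 0\<close>] assms(2)] by blast
  have g: "g \<in> carrier AG" using U openin_imp_subset by blast
  have "q \<in> U" if "q \<in> carrier AG" "close (absv \<pi> ^ n) q g" for q
  proof -
    have "dist q g \<le> C * absv \<pi> ^ n" unfolding C_def by (rule dist_le_if_close[OF that(2)])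
    also have "\<dots> < e" using n \<open>C > 0\<close> by (simp add: field_simps)
    finally show ?thesis using e(2) that(1) by (auto simp: dist_commute)
  qed
  then show "\<exists>n. g <#\<^bsub>AG\<^esub> congruence_subgroup (absv \<pi> ^ n) \<subseteq> U"
    unfolding l_coset_congruence[OF pos g] by blast
qed

section \<open>Diagonal vectors and their conjugates under scalar matrices\<close>

definition diagonal_vector :: "'f \<Rightarrow> ('f^'n) \<times> ('f^'n^'n)"
  where "diagonal_vector a = ((\<chi> i. a), mat 1)"

lemma mat_1_GL: "mat 1 \<in> GL"
  using group.is_monoid[OF group_GL_integers, THEN Group.monoid.one_closed]
  by (simp add: carrier_GL_integers one_GL_integers)

lemma diagonal_vector_closed:
  "a \<in> integers_of absv \<Longrightarrow> (diagonal_vector a :: ('f^'n) \<times> ('f^'n^'n)) \<in> carrier AG"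
  by (simp add: diagonal_vector_def carrier_AG mat_1_GL)

lemma diagonal_vector_add: "diagonal_vector (a + b) = diagonal_vector a \<otimes>\<^bsub>AG\<^esub> diagonal_vector b"
  by (simp add: diagonal_vector_def mult_AG vec_eq_iff)

lemma diagonal_vector_in_congruence_iff:
  assumes "a \<in> integers_of absv" "e \<ge> 0"
  shows "(diagonal_vector a :: ('f^'n) \<times> ('f^'n^'n)) \<in> congruence_subgroup e \<longleftrightarrow> absv a \<le> e"
  using assms diagonal_vector_closed[OF assms(1), where 'n = 'n] unfolding congruence_subgroup_def
  by (simp add: close_def vec_close_def mat_close_def one_AG diagonal_vector_def)

lemma mat_mult_mat: "(mat a :: 'f^'n^'n) ** mat b = mat (a * b)"
proof -
  have "(if i = k then a else 0) * (if k = j then b else 0) = (if k = i then (if i = j then a * b else 0) else 0)"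
    for i j k :: 'n by simp
  then show ?thesis by (simp add: vec_eq_iff matrix_matrix_mult_def mat_def)
qed

lemma mat_mult_vec: "(mat a :: 'f^'n^'n) *v x = (\<chi> i. a * x $ i)"
proof -
  have "(if i = k then a else 0) * x $ k = (if k = i then a * x $ i else 0)" for i k :: 'n by simp
  then show ?thesis by (simp add: vec_eq_iff matrix_vector_mult_def mat_def)
qed

lemma central_radial:
  fixes u :: "('f^'n) \<times> ('f^'n^'n) \<Rightarrow> complex"
  assumes u: "\<And>g x. g \<in> carrier AG \<Longrightarrow> x \<in> carrier AG \<Longrightarrow> u (g \<otimes>\<^bsub>AG\<^esub> x \<otimes>\<^bsub>AG\<^esub> inv\<^bsub>AG\<^esub> g) = u x"
    and ab: "a \<in> integers_of absv" "b \<in> integers_of absv" "absv a = absv b"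
  shows "u (diagonal_vector a) = u (diagonal_vector b)"
proof (cases "a = 0")
  case True
  then show ?thesis using ab(3) absv_eq_0_iff[of b] by simp
next
  case False
  interpret Group.group "AG :: (('f^'n) \<times> ('f^'n^'n)) monoid" by (rule group_AG)
  have "b \<noteq> 0" using False ab(3) absv_eq_0_iff by metis
  \<comment> \<open>Conjugating by the scalar matrix \<open>b / a\<close> moves one diagonal vector to the other.\<close>
  define c where "c = b / a"
  have "absv c * absv a = absv b" using False by (simp add: c_def absv_mult[symmetric])
  moreover have "absv a \<noteq> 0" using False absv_eq_0_iff by simp
  ultimately have "absv c = 1" using ab(3) by simp
  moreover have "absv c * absv (inverse c) = 1"
    using False \<open>b \<noteq> 0\<close> by (simp add: absv_mult[symmetric] c_def)
  ultimately have "c \<in> integers_of absv" "inverse c \<in> integers_of absv" by (auto simp: integers_of_def)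
  then have "mat c \<in> (GL :: ('f^'n^'n) set)"
    unfolding GL_def using mat_integral False \<open>b \<noteq> 0\<close>
    by (auto simp: mat_mult_mat c_def intro!: exI[of _ "mat (inverse c)"])
  then have g: "(0, mat c) \<in> carrier (AG :: (('f^'n) \<times> ('f^'n^'n)) monoid)"
    by (simp add: carrier_AG integers_of_closed)
  have "(0, mat c) \<otimes>\<^bsub>AG\<^esub> diagonal_vector a = diagonal_vector b \<otimes>\<^bsub>AG\<^esub> ((0 :: 'f^'n), mat c)"
    using False by (simp add: mult_AG diagonal_vector_def mat_mult_vec c_def vec_eq_iff)
  then have "(0, mat c) \<otimes>\<^bsub>AG\<^esub> diagonal_vector a \<otimes>\<^bsub>AG\<^esub> inv\<^bsub>AG\<^esub> (0, mat c)
      = (diagonal_vector b :: ('f^'n) \<times> ('f^'n^'n))"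
    using g diagonal_vector_closed[OF ab(2), where 'n = 'n] by (simp add: m_assoc)
  then show ?thesis using u[OF g diagonal_vector_closed[OF ab(1)]] by simp
qed

lemma not_amenable_central_fourier_algebra:
  "\<not> amenable (central_fourier_algebra (AG :: (('f^'n) \<times> ('f^'n^'n)) monoid))"
proof -
  let ?G = "AG :: (('f^'n) \<times> ('f^'n^'n)) monoid"
  let ?A = "central_fourier_algebra ?G"
  let ?\<tau> = "diagonal_vector :: 'f \<Rightarrow> ('f^'n) \<times> ('f^'n^'n)"
  obtain \<pi> where \<pi>: "0 < absv \<pi>" "absv \<pi> < 1" using exists_small by blast
  interpret G: compact_group_with_subgroups ?G "\<lambda>n. congruence_subgroup (absv \<pi> ^ n)"
    by (rule compact_group_AG[OF \<pi>])
  interpret G: haar_group_with_integers ?G "haar ?G" absv ?\<tau> \<pi>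
    by unfold_locales (use \<pi> diagonal_vector_closed diagonal_vector_add in auto)
  have pos: "absv \<pi> ^ n \<ge> 0" for n using \<pi> by simp
  have carrier_A: "u \<in> fourier_functions ?G"
    "\<And>g x. g \<in> carrier ?G \<Longrightarrow> x \<in> carrier ?G \<Longrightarrow> u (g \<otimes>\<^bsub>?G\<^esub> x \<otimes>\<^bsub>?G\<^esub> inv\<^bsub>?G\<^esub> g) = u x"
    if "u \<in> carrier ?A" for u
    using that by (auto simp: central_fourier_algebra_def)
  have nrm_A: "nrm ?A = fourier_norm ?G" by (simp add: central_fourier_algebra_def)
  have coefficient: "u (?\<tau> a) = G.inner_L2 (G.translate (?\<tau> a) \<xi>) \<eta>"
    if "u = regular_coefficient ?G \<xi> \<eta>" "a \<in> integers_of absv" for u \<xi> \<eta> a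
    using that diagonal_vector_closed[OF that(2), where 'n = 'n] by (simp add: regular_coefficient_def G.regular_coefficient_eq)
  have "inj (\<lambda>n. ?\<tau> (\<pi> ^ n))"
  proof (rule injI)
    fix n m assume "?\<tau> (\<pi> ^ n) = ?\<tau> (\<pi> ^ m)"
    then have "absv \<pi> ^ n = absv \<pi> ^ m" by (simp add: diagonal_vector_def vec_eq_iff flip: absv_power)
    then show "n = m" using \<pi> power_inject_exp'[of "absv \<pi>" n m] by simp
  qed
  \<comment> \<open>The constant 3 comes from the variation bound; point evaluations are bounded by
    the norm itself.\<close>
  then show ?thesis
  proof (rule not_amenable_if_variation_bounded[where K = 3])
    fix u n assume u: "u \<in> carrier ?A"
    show "cmod (u (?\<tau> (\<pi> ^ n))) \<le> 3 * nrm ?A u"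
      unfolding nrm_A
    proof (rule fourier_norm_bound[OF carrier_A(1)[OF u]])
      fix \<xi> \<eta> assume *: "\<xi> \<in> L2 (haar ?G)" "\<eta> \<in> L2 (haar ?G)" "u = regular_coefficient ?G \<xi> \<eta>"
      show "cmod (u (?\<tau> (\<pi> ^ n))) \<le> 3 * (L2_norm (haar ?G) \<xi> * L2_norm (haar ?G) \<eta>)"
        using G.inner_L2_translate_le[OF diagonal_vector_closed[OF G.\<pi>_power_integer] *(1,2), of n]
          mult_nonneg_nonneg[OF G.L2_norm_nonneg[of \<xi>] G.L2_norm_nonneg[of \<eta>]]
        unfolding coefficient[OF *(3) G.\<pi>_power_integer] by linarith
    qed simp
    show "(\<Sum>k<n. cmod (u (?\<tau> (\<pi> ^ Suc k)) - u (?\<tau> (\<pi> ^ k)))) \<le> 3 * nrm ?A u"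
      unfolding nrm_A
    proof (rule fourier_norm_bound[OF carrier_A(1)[OF u]])
      fix \<xi> \<eta> assume *: "\<xi> \<in> L2 (haar ?G)" "\<eta> \<in> L2 (haar ?G)" "u = regular_coefficient ?G \<xi> \<eta>"
      show "(\<Sum>k<n. cmod (u (?\<tau> (\<pi> ^ Suc k)) - u (?\<tau> (\<pi> ^ k))))
          \<le> 3 * (L2_norm (haar ?G) \<xi> * L2_norm (haar ?G) \<eta>)"
        unfolding coefficient[OF *(3) G.\<pi>_power_integer]
      proof (rule G.radial_variation[OF *(1,2)])
        fix a b assume ab: "a \<in> integers_of absv" "b \<in> integers_of absv" "absv a = absv b"
        show "G.inner_L2 (G.translate (?\<tau> a) \<xi>) \<eta> = G.inner_L2 (G.translate (?\<tau> b) \<xi>) \<eta>"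
          using central_radial[OF carrier_A(2)[OF u] ab]
          by (simp add: coefficient[OF *(3) ab(1)] coefficient[OF *(3) ab(2)])
      qed
    qed simp
  next
    fix n
    \<comment> \<open>The level \<open>Suc n\<close> is fine enough to exclude the n-th point and
      still contains the next one.\<close>
    let ?u = "\<lambda>x. of_bool (x \<in> congruence_subgroup (absv \<pi> ^ Suc n)) :: complex"
    have "?u \<in> carrier ?A"
      using G.indicator_in_fourier_functions[of "Suc n"] conjugate_in_congruence_iff[OF pos, where 'n = 'n]
      by (simp add: central_fourier_algebra_def del: power_Suc)
    moreover have "?u (?\<tau> (\<pi> ^ Suc n)) = 1"
      using diagonal_vector_in_congruence_iff[OF G.\<pi>_power_integer pos, of "Suc n" "Suc n", where 'n = 'n]
      by (simp add: absv_power del: power_Suc)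
    moreover have "absv \<pi> ^ Suc n < absv \<pi> ^ n" using \<pi> by simp
    then have "?u (?\<tau> (\<pi> ^ n)) = 0"
      using diagonal_vector_in_congruence_iff[OF G.\<pi>_power_integer pos, of n "Suc n", where 'n = 'n]
      by (simp add: absv_power del: power_Suc)
    ultimately show "\<exists>u\<in>carrier ?A. u (?\<tau> (\<pi> ^ Suc n)) \<noteq> u (?\<tau> (\<pi> ^ n))"
      by (intro bexI[of _ ?u]) auto
  qed (auto simp: central_fourier_algebra_def)
qed

end

theorem corollary3p6:
  fixes absv :: "'f::{field,metric_space} \<Rightarrow> real"
  assumes "nonarch_local_field absv"
  shows "\<not> amenable (central_fourier_algebra
    (affine_integers absv :: (('f^'n) \<times> ('f^'n^'n)) monoid))"
  by (rule nonarch_local_field.not_amenable_central_fourier_algebra[OF assms])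

end
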